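(* Let $(G,H,\mathcal L)$ be a cut-and-project scheme with $G$ non-compact, let $W\subset H$ be relatively compact, and let $\mathcal A=(A_n)_{n\in\mathbb N}$ be any van Hove sequence in $G$. Then: (i) For every $\xi\in G\times H$ and every compact unit neighbourhood $U\subset H$, $$h^*_{\mathcal A}(\Lambda(W))\le\limsup_{n\to\infty} f_n(\partial^U W,\xi)\log 2\le \mathrm{dens}(\mathcal L)\,\theta_H(\partial^U W)\log2.$$ (ii) $h^*_{\mathcal A}(\Lambda(W))\le\mathrm{dens}(\mathcal L)\,\theta_H(\partial W)\log 2$. (iii) For every relatively compact $W_0\subset H$ with $\theta_H(\partial W_0)=0$ and $W\subset W_0$, $$h^*_{\mathcal A}(\Lambda(W),\Lambda(W_0))\le \mathrm{dens}(\mathcal L)\,\theta_H(\partial W)\log 2.$$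
   Context: Groups are written multiplicatively; $|\cdot|$ denotes cardinality; $\partial$ is topological boundary. A cut-and-project scheme is a triple $(G,H,\mathcal L)$ where $G,H$ are $\sigma$-compact locally compact Hausdorff abelian groups and $\mathcal L$ is a discrete subgroup of $G\times H$ with $(G\times H)/\mathcal L$ compact, such that $\pi_G|_{\mathcal L}$ is one-to-one and $\pi_H(\mathcal L)$ is dense in $H$ ($\pi_G,\pi_H$ the canonical projections). Put $L=\pi_G(\mathcal L)$, star map $\ell^\star=\pi_H(\pi_G|_{\mathcal L}^{-1}(\ell))$, and $\Lambda(V)=\{\ell\in L:\ell^\star\in V\}$ for $V\subset H$. Fix Haar measures $\theta_G$ on $G$ (written $\theta$) and $\theta_H$ on $H$, and the product measure on $G\times H$; $1/\mathrm{dens}(\mathcal L)$ is the (common, finite) measure of a measurable relatively compact fundamental domain of $\mathcal L$. For $U,V$ subsets of a group, $\partial^U V=(U\mathrm{cl}(V)\cap\mathrm{cl}(V^c))\cup(U\mathrm{cl}(V^c)\cap\mathrm{cl}(V))$. A van Hove sequence in $G$ is a sequence $(A_n)$ of compact sets with $\theta_G(A_n)>0$ and $\theta_G(\partial^K A_n)/\theta_G(A_n)\to0$ for every compact $K\subset G$. For $V\subset H$ and $\xi=(t,h)\in G\times H$, $f_n(V,\xi)=\frac{1}{\theta_G(A_n)}|t\Lambda(hV)\cap A_n|$. For a discrete set $D\subset G$ and compact $A\subset G$, $N^*_A(D)=|\{x^{-1}D\cap A: x\in D\}|$, and the pattern entropy is $h^*_{\mathcal A}(D)=\limsup_{n\to\infty}\frac{1}{\theta_G(A_n)}\log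 N^*_{A_n}(D)$ with the convention $\log 0=0$. For $D\subset D_0\subset G$, $N^*_A(D,D_0)=|\{1_{x^{-1}D\cap A}:x\in D_0\}|$, where $1_{x^{-1}D\cap A}:x^{-1}D_0\cap A\to\{0,1\}$ is the characteristic function of $x^{-1}D\cap A$ on $x^{-1}D_0\cap A$; the coloured pattern entropy is $h^*_{\mathcal A}(D,D_0)=\limsup_{n\to\infty}\frac{1}{\theta_G(A_n)}\log N^*_{A_n}(D,D_0)$. (In the paper's terminology, $\Lambda(W)$ is a weak model set and $\Lambda(W_0)$ a regular model set.) *)

theory Defs
  imports "HOL-Analysis.Analysis" "HOL-Library.Set_Algebras"
begin

text \<open>
  Groups are written additively, since the topological group classes are additive:
  \<open>x +o D\<close> is the translate $xD$, \<open>(- x) +o D\<close> is $x^{-1}D$, and \<open>U + V\<close> for sets is the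
  product set $UV$.
\<close>

section \<open>Groups and Haar measures\<close>

definition relatively_compact :: "'a::topological_space set \<Rightarrow> bool" where
  "relatively_compact S \<longleftrightarrow> compact (closure S)"

text \<open>The topological group itself is the type, hence the type argument.\<close>

definition sigma_compact_lc_group :: "'a::{topological_ab_group_add, t2_space} itself \<Rightarrow> bool" where
  "sigma_compact_lc_group _ \<longleftrightarrow>
     locally_compact_space (euclidean :: 'a topology) \<and>
     (\<exists>K :: nat \<Rightarrow> 'a set. (\<forall>n. compact (K n)) \<and> (\<Union>n. K n) = UNIV)"

definition haar_measure :: "'a::{topological_ab_group_add, t2_space} measure \<Rightarrow> bool" where
  "haar_measure \<theta> \<longleftrightarrow>
     sets \<theta> = sets borel \<and>
     emeasure \<theta> UNIV \<noteq> 0 \<and>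
     (\<forall>x. \<forall>B\<in>sets borel. emeasure \<theta> (x +o B) = emeasure \<theta> B) \<and>
     (\<forall>K. compact K \<longrightarrow> emeasure \<theta> K < \<infinity>) \<and>
     (\<forall>B\<in>sets borel. emeasure \<theta> B = (INF T\<in>{T. open T \<and> B \<subseteq> T}. emeasure \<theta> T)) \<and>
     (\<forall>T. open T \<longrightarrow> emeasure \<theta> T = (SUP K\<in>{K. compact K \<and> K \<subseteq> T}. emeasure \<theta> K))"

text \<open>The quotient group with the quotient topology; its points are the cosets of \<open>N\<close>.\<close>

definition quotient_topology :: "'a::{topological_space, ab_group_add} set \<Rightarrow> 'a set topology" where
  "quotient_topology N =
     topology (\<lambda>\<U>. \<U> \<subseteq> range (\<lambda>x. x +o N) \<and> open ((\<lambda>x. x +o N) -` \<U>))"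

lemma openin_quotient_topology:
  "openin (quotient_topology N) \<U> \<longleftrightarrow>
     \<U> \<subseteq> range (\<lambda>x. x +o N) \<and> open ((\<lambda>x. x +o N) -` \<U>)"
proof -
  have "istopology (\<lambda>\<U>. \<U> \<subseteq> range (\<lambda>x. x +o N) \<and> open ((\<lambda>x. x +o N) -` \<U>))"
    unfolding istopology_def by (auto simp: vimage_Union intro!: open_Int open_UN)
  then show ?thesis
    by (simp add: quotient_topology_def topology_inverse')
qed

lemma quotient_map_quotient_topology:
  "quotient_map euclidean (quotient_topology N) (\<lambda>x. x +o N)"
proof -
  have "topspace (quotient_topology N) = range (\<lambda>x. x +o N)"
  proof (rule subset_antisym)
    show "topspace (quotient_topology N) \<subseteq> range (\<lambda>x. x +o N)"
      unfolding topspace_def by (auto simp: openin_quotient_topology)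
    have "openin (quotient_topology N) (range (\<lambda>x. x +o N))"
      by (simp add: openin_quotient_topology vimage_def)
    then show "range (\<lambda>x. x +o N) \<subseteq> topspace (quotient_topology N)"
      by (rule openin_subset)
  qed
  then show ?thesis
    by (auto simp: quotient_map_def openin_quotient_topology vimage_def)
qed

section \<open>Cut-and-project schemes\<close>

definition cut_and_project_scheme ::
  "('g::{topological_ab_group_add, t2_space} \<times> 'h::{topological_ab_group_add, t2_space}) set \<Rightarrow> bool"
where
  "cut_and_project_scheme \<L> \<longleftrightarrow>
     sigma_compact_lc_group TYPE('g) \<and> sigma_compact_lc_group TYPE('h) \<and>
     0 \<in> \<L> \<and> (\<forall>x\<in>\<L>. \<forall>y\<in>\<L>. x + y \<in> \<L>) \<and> (\<forall>x\<in>\<L>. - x \<in> \<L>) \<and>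
     discrete \<L> \<and>
     compact_space (quotient_topology \<L>) \<and>
     inj_on fst \<L> \<and>
     closure (snd ` \<L>) = UNIV"

definition star_map :: "('g \<times> 'h) set \<Rightarrow> 'g \<Rightarrow> 'h" where
  "star_map \<L> l = snd (inv_into \<L> fst l)"

definition model_set :: "('g \<times> 'h) set \<Rightarrow> 'h set \<Rightarrow> 'g set" where
  "model_set \<L> V = {l \<in> fst ` \<L>. star_map \<L> l \<in> V}"

text \<open>
  Measurability is with respect to the product $\sigma$-algebra. It may be smaller than the Borel
  $\sigma$-algebra of the product space when the groups are not second countable, but, \<open>\<L>\<close> being a
  lattice in a $\sigma$-compact group, it still contains relatively compact fundamental domains
  (built from finitely many translates of open boxes).
\<close>

definition fundamental_domain ::
  "'g::{topological_ab_group_add, t2_space} measure \<Rightarrow> 'h::{topological_ab_group_add, t2_space} measure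
     \<Rightarrow> ('g \<times> 'h) set \<Rightarrow> ('g \<times> 'h) set \<Rightarrow> bool" where
  "fundamental_domain \<theta>G \<theta>H \<L> F \<longleftrightarrow>
     F \<in> sets (\<theta>G \<Otimes>\<^sub>M \<theta>H) \<and> relatively_compact F \<and> (\<forall>x. \<exists>!y. y \<in> F \<and> x - y \<in> \<L>)"

text \<open>All fundamental domains have the same measure, so the choice is immaterial.\<close>

definition dens ::
  "'g::{topological_ab_group_add, t2_space} measure \<Rightarrow> 'h::{topological_ab_group_add, t2_space} measure
     \<Rightarrow> ('g \<times> 'h) set \<Rightarrow> real" where
  "dens \<theta>G \<theta>H \<L> = 1 / measure (\<theta>G \<Otimes>\<^sub>M \<theta>H) (SOME F. fundamental_domain \<theta>G \<theta>H \<L> F)"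

section \<open>Van Hove sequences\<close>

definition van_Hove_boundary ::
  "'a::{topological_ab_group_add, t2_space} set \<Rightarrow> 'a set \<Rightarrow> 'a set" where
  "van_Hove_boundary U V =
     ((U + closure V) \<inter> closure (- V)) \<union> ((U + closure (- V)) \<inter> closure V)"

definition van_Hove_sequence ::
  "'g::{topological_ab_group_add, t2_space} measure \<Rightarrow> (nat \<Rightarrow> 'g set) \<Rightarrow> bool" where
  "van_Hove_sequence \<theta> A \<longleftrightarrow>
     (\<forall>n. compact (A n) \<and> measure \<theta> (A n) > 0) \<and>
     (\<forall>K. compact K \<longrightarrow>
        (\<lambda>n. measure \<theta> (van_Hove_boundary K (A n)) / measure \<theta> (A n)) \<longlonglongrightarrow> 0)"

definition relative_frequency ::
  "'g::ab_group_add measure \<Rightarrow> ('g \<times> 'h::ab_group_add) set \<Rightarrow> (nat \<Rightarrow> 'g set)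
     \<Rightarrow> nat \<Rightarrow> 'h set \<Rightarrow> 'g \<times> 'h \<Rightarrow> real" where
  "relative_frequency \<theta> \<L> A n V \<xi> =
     real (card ((fst \<xi> +o model_set \<L> (snd \<xi> +o V)) \<inter> A n)) / measure \<theta> (A n)"

section \<open>Pattern entropy\<close>

definition pattern_number :: "'g::ab_group_add set \<Rightarrow> 'g set \<Rightarrow> nat" where
  "pattern_number A D = card {((- x) +o D) \<inter> A |x. x \<in> D}"

text \<open>
  The convention $\log 0 = 0$ is built into the library function \<open>ln\<close> (\<open>ln_0\<close>).
\<close>

definition pattern_entropy ::
  "'g::ab_group_add measure \<Rightarrow> (nat \<Rightarrow> 'g set) \<Rightarrow> 'g set \<Rightarrow> ereal" where
  "pattern_entropy \<theta> A D =
     limsup (\<lambda>n. ereal (ln (real (pattern_number (A n) D)) / measure \<theta> (A n)))"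

text \<open>
  Functions that differ only in their domain must count as different, so a $\{0,1\}$-valued function
  on \<open>Q\<close> is encoded as a partial map with domain exactly \<open>Q\<close>. (With \<open>restrict\<close>, the value
  \<open>undefined\<close> outside \<open>Q\<close> might coincide with 0 or 1.)
\<close>

definition colouring :: "'g set \<Rightarrow> 'g set \<Rightarrow> ('g \<rightharpoonup> nat)" where
  "colouring P Q = (\<lambda>y. if y \<in> Q then Some (indicator P y) else None)"

definition coloured_pattern_number :: "'g::ab_group_add set \<Rightarrow> 'g set \<Rightarrow> 'g set \<Rightarrow> nat" where
  "coloured_pattern_number A D D\<^sub>0 =
     card {colouring (((- x) +o D) \<inter> A) (((- x) +o D\<^sub>0) \<inter> A) |x. x \<in> D\<^sub>0}"

definition coloured_pattern_entropy ::
  "'g::ab_group_add measure \<Rightarrow> (nat \<Rightarrow> 'g set) \<Rightarrow> 'g set \<Rightarrow> 'g set \<Rightarrow> ereal" where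
  "coloured_pattern_entropy \<theta> A D D\<^sub>0 =
     limsup (\<lambda>n. ereal (ln (real (coloured_pattern_number (A n) D D\<^sub>0)) / measure \<theta> (A n)))"

end

theory Submission
  imports Defs
begin

text \<open>
  A point \<open>x\<close> of \<open>\<Lambda>(W)\<close> sees the pattern \<open>\<Lambda>(W - x\<^sup>\<star>)\<close>, so patterns are indexed by the parameter
  \<open>b = x\<^sup>\<star>\<close> in the relatively compact set \<open>W\<close>. Moving \<open>b\<close> by less than \<open>U\<close> only affects lattice points whose
  image lies in a translate of \<open>\<partial>\<^sup>U W\<close>. Since the star image of the lattice is dense, finitely many
  parameters, each differing from a prescribed one by an element of that image, come within \<open>U\<close>
  of every \<open>b\<close>; hence there are at most a constant times \<open>2\<^sup>m\<close> patterns, where \<open>m\<close> bounds the number of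
  points of the corresponding sets over \<open>A\<^sub>n\<close>, all of which are translates in \<open>G\<close> of
  one set \<open>t\<Lambda>(h\<partial>\<^sup>U W)\<close>. The van Hove property absorbs the translations, and
  \<open>\<theta>(A\<^sub>n) \<rightarrow> \<infinity>\<close> absorbs the constant.

  The density bound is a packing argument. Shift each lattice point over \<open>A\<^sub>n \<times> K\<close> by a fundamental
  domain, cut into finitely many pieces each moved by a lattice vector that makes its
  \<open>H\<close>-component nearly constant (density of the star image again): this gives disjoint sets of
  total measure \<open>1 / dens\<close> per lattice point inside \<open>(A\<^sub>n + C) \<times> T\<close>, for a fixed compact \<open>C\<close> and an open
  \<open>T\<close> slightly larger than \<open>K\<close>.
\<close>

section \<open>Compact sets and van Hove boundaries in topological groups\<close>

lemma compact_set_plus: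
  fixes K C :: "'a::{topological_ab_group_add, t2_space} set"
  assumes "compact K" "compact C"
  shows "compact (K + C)"
proof -
  have "K + C = (\<lambda>p. fst p + snd p) ` (K \<times> C)"
    by (force simp: set_plus_def)
  moreover have "compact ((\<lambda>p. fst p + snd p) ` (K \<times> C))"
    by (intro compact_continuous_image continuous_intros compact_Times assms)
  ultimately show ?thesis by simp
qed

lemma elt_set_plus_eq_vimage: "x +o S = (\<lambda>y. y - x) -` S" for x :: "'a::ab_group_add"
  by (auto simp: set_minus_plus)

lemma open_elt_set_plus:
  fixes x :: "'a::{topological_ab_group_add, t2_space}"
  assumes "open S"
  shows "open (x +o S)"
  unfolding elt_set_plus_eq_vimage by (intro open_vimage assms continuous_intros)

lemma compact_elt_set_plus:
  fixes x :: "'a::{topological_ab_group_add, t2_space}"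
  assumes "compact S"
  shows "compact (x +o S)"
proof -
  have "x +o S = (+) x ` S" by (auto simp: elt_set_plus_def)
  then show ?thesis using assms by (auto intro!: compact_continuous_image continuous_intros)
qed

lemma open_zero_diff:
  fixes T :: "'a::{topological_ab_group_add, t2_space} set"
  assumes "open T" "0 \<in> T"
  obtains V where "open V" "0 \<in> V" "\<And>x y. x \<in> V \<Longrightarrow> y \<in> V \<Longrightarrow> x - y \<in> T"
proof -
  have "open ((\<lambda>p::'a\<times>'a. fst p - snd p) -` T)"
    by (intro open_vimage assms continuous_intros)
  moreover have "(0, 0) \<in> (\<lambda>p::'a\<times>'a. fst p - snd p) -` T" using assms by simp
  ultimately obtain A B where AB: "open A" "open B" "(0,0) \<in> A \<times> B"
    "A \<times> B \<subseteq> (\<lambda>p::'a\<times>'a. fst p - snd p) -` T"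
    by (rule open_prod_elim)
  show thesis
    by (rule that[of "A \<inter> B"]) (use AB in auto)
qed

text \<open>The tube lemma around the compact slice \<open>{0} \<times> K\<close> of the open
  preimage of \<open>T\<close> under addition gives one neighbourhood that serves all of
  \<open>K\<close>.\<close>

lemma compact_plus_nbhd_subset_open:
  fixes K T :: "'a::{topological_ab_group_add, t2_space} set"
  assumes "compact K" "open T" "K \<subseteq> T"
  obtains V where "open V" "0 \<in> V" "K + V \<subseteq> T"
proof -
  have "open ((\<lambda>p::'a\<times>'a. fst p + snd p) -` T)"
    by (intro open_vimage assms continuous_intros)
  moreover have "{0} \<times> K \<subseteq> (\<lambda>p::'a\<times>'a. fst p + snd p) -` T" using assms by auto
  ultimately obtain V where "0 \<in> V" "open V" "V \<times> K \<subseteq> (\<lambda>p::'a\<times>'a. fst p + snd p) -` T"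
    using Elementary_Topology.tube_lemma[OF assms(1), of "(\<lambda>p. fst p + snd p) -` T" 0] by blast
  then show thesis
    by (intro that[of V]) (auto simp: set_plus_def subset_iff, metis add.commute)
qed

text \<open>For \<open>z\<close> outside \<open>K + C\<close> the compact set \<open>z - K\<close>
  misses the closed set \<open>C\<close>, and so does \<open>(z - K) + V\<close> for some
  neighbourhood \<open>V\<close> of 0; hence \<open>z + V\<close> misses
  \<open>K + C\<close>.\<close>

lemma closed_compact_plus_closed:
  fixes K C :: "'a::{topological_ab_group_add, t2_space} set"
  assumes "compact K" "closed C"
  shows "closed (K + C)"
  unfolding closed_def
proof (subst open_subopen, intro ballI)
  fix z assume z: "z \<in> - (K + C)"
  have "(\<lambda>k. z - k) ` K \<subseteq> - C"
    using z by (force simp: set_plus_def)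
  moreover have "compact ((\<lambda>k. z - k) ` K)"
    by (intro compact_continuous_image continuous_intros assms)
  moreover have "open (- C)" using assms by auto
  ultimately obtain V where V: "open V" "0 \<in> V" "(\<lambda>k. z - k) ` K + V \<subseteq> - C"
    using compact_plus_nbhd_subset_open by metis
  have "z +o V \<subseteq> - (K + C)"
  proof
    fix y assume "y \<in> z +o V"
    then obtain v where v: "v \<in> V" "y = z + v" by (auto simp: elt_set_plus_def)
    show "y \<in> - (K + C)"
    proof
      assume "y \<in> K + C"
      then obtain k c where kc: "k \<in> K" "c \<in> C" "y = k + c" by (auto simp: set_plus_def)
      have "(z - k) + v \<in> (\<lambda>k. z - k) ` K + V" using kc v by blast
      moreover have "(z - k) + v = c" using kc v by (simp add: algebra_simps)
      ultimately show False using V kc by auto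
    qed
  qed
  moreover have "open (z +o V)" using V by (intro open_elt_set_plus)
  moreover have "z \<in> z +o V" using V set_plus_intro2[of 0 V z] by simp
  ultimately show "\<exists>T. open T \<and> z \<in> T \<and> T \<subseteq> - (K + C)" by blast
qed

lemma compact_closure_nbhd_zero:
  fixes T :: "'a::{topological_ab_group_add, t2_space} set"
  assumes "sigma_compact_lc_group TYPE('a)" "open T" "0 \<in> T"
  obtains V where "open V" "0 \<in> V" "V \<subseteq> T" "compact (closure V)"
proof -
  have "\<exists>U K. open U \<and> compact K \<and> (0::'a) \<in> U \<and> U \<subseteq> K"
    using assms(1) by (auto simp: sigma_compact_lc_group_def locally_compact_space_def)
  then obtain U K where UK: "open U" "compact K" "(0::'a) \<in> U" "U \<subseteq> K" by blast
  have "closure (U \<inter> T) \<subseteq> K"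
    by (intro closure_minimal compact_imp_closed UK) (use UK in auto)
  then have "compact (closure (U \<inter> T))"
    using UK(2) by (metis closed_closure closed_Int_compact inf.absorb1)
  then show thesis using UK assms by (intro that[of "U \<inter> T"]) auto
qed

text \<open>If all differences of points of \<open>V\<close> lie in \<open>T\<close>, then so does
  the closure of any neighbourhood \<open>V' \<subseteq> V\<close> of 0: for \<open>x\<close> in
  that closure \<open>x + V'\<close> meets \<open>V'\<close>, so \<open>x\<close> is such a
  difference.\<close>

lemma compact_neighbourhood_zero:
  fixes T :: "'a::{topological_ab_group_add, t2_space} set"
  assumes "sigma_compact_lc_group TYPE('a)" "open T" "0 \<in> T"
  obtains K where "compact K" "0 \<in> interior K" "K \<subseteq> T"
proof -
  obtain V where V: "open V" "0 \<in> V" "\<And>x y. x \<in> V \<Longrightarrow> y \<in> V \<Longrightarrow> x - y \<in> T"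
    using open_zero_diff[OF assms(2,3)] by blast
  obtain V' where V': "open V'" "0 \<in> V'" "V' \<subseteq> V" "compact (closure V')"
    using compact_closure_nbhd_zero[OF assms(1) V(1,2)] .
  show thesis
  proof (rule that[OF V'(4)])
    show "0 \<in> interior (closure V')"
      using interior_maximal[OF closure_subset V'(1)] V'(2) by (rule subsetD)
    show "closure V' \<subseteq> T"
    proof
      fix x assume x: "x \<in> closure V'"
      have "open (x +o V')" "x \<in> x +o V'"
        using open_elt_set_plus[OF V'(1)] set_plus_intro2[OF V'(2), of x] by simp_all
      with x have "(x +o V') \<inter> V' \<noteq> {}" by (auto simp: closure_iff_nhds_not_empty)
      then obtain v where v: "v \<in> V'" "x + v \<in> V'" by (auto simp: elt_set_plus_def)
      then have "(x + v) - v \<in> T" using V'(3) by (intro V(3)) auto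
      then show "x \<in> T" by simp
    qed
  qed
qed

section \<open>Van Hove boundaries and their relation to the frontier\<close>

lemma closed_van_Hove_boundary: "compact K \<Longrightarrow> closed (van_Hove_boundary K V)"
  unfolding van_Hove_boundary_def
  by (intro closed_Un closed_Int closed_compact_plus_closed closed_closure)

lemma compact_van_Hove_boundary:
  assumes "compact K" "compact (closure V)"
  shows "compact (van_Hove_boundary K V)"
proof -
  have "van_Hove_boundary K V \<subseteq> (K + closure V) \<union> closure V"
    by (auto simp: van_Hove_boundary_def)
  moreover have "compact ((K + closure V) \<union> closure V)"
    by (intro compact_Un compact_set_plus assms)
  ultimately show ?thesis
    using closed_van_Hove_boundary[OF assms(1)] by (metis closed_Int_compact inf.absorb1)
qed

lemma van_Hove_boundary_empty [simp]: "van_Hove_boundary K {} = {}"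
  by (simp add: van_Hove_boundary_def set_plus_def)

text \<open>The part of \<open>closure W\<close> away from the frontier is compact and disjoint from
  \<open>closure (- W)\<close>, so small moves cannot carry it there. Hence a small \<open>U\<close>
  produces boundary points near the frontier only; this links van Hove boundaries to the topological
  one.\<close>

lemma van_Hove_boundary_shrink:
  fixes W T :: "'a::{topological_ab_group_add, t2_space} set"
  assumes lc: "sigma_compact_lc_group TYPE('a)"
    and W: "compact (closure W)" and T: "open T" "frontier W \<subseteq> T"
  obtains V where "open V" "0 \<in> V" "\<And>U. U \<subseteq> V \<Longrightarrow> van_Hove_boundary U W \<subseteq> T"
proof -
  have fW: "frontier W = closure W \<inter> closure (- W)"
    by (auto simp: frontier_def closure_interior)
  have "compact (frontier W)"
    using W by (metis closed_Int_compact fW closed_closure inf_commute)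
  then obtain V1 where V1: "open V1" "0 \<in> V1" "frontier W + V1 \<subseteq> T"
    using compact_plus_nbhd_subset_open T by metis
  obtain V2 where V2: "open V2" "0 \<in> V2" "\<And>x y. x \<in> V2 \<Longrightarrow> y \<in> V2 \<Longrightarrow> x - y \<in> V1"
    using open_zero_diff V1 by metis
  have V2': "x + y \<in> V1" if "x \<in> V2" "- y \<in> V2" for x y
    using V2(3)[OF that] by simp
  \<comment> \<open>Thickened by \<open>V2\<close> only, so that one more small move still ends in
    \<open>T\<close>.\<close>
  let ?O = "\<Union>x\<in>frontier W. x +o V2"
  have O: "open ?O" using V2 by (auto intro!: open_elt_set_plus)
  have fO: "frontier W \<subseteq> ?O" using V2 set_plus_intro2[of 0 V2] by force
  have "?O \<subseteq> T"
  proof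
    fix z assume "z \<in> ?O"
    then obtain x v where "x \<in> frontier W" "v \<in> V2" "z = x + v" by (auto simp: elt_set_plus_def)
    moreover have "v \<in> V1" using V2(3)[OF \<open>v \<in> V2\<close> V2(2)] by simp
    ultimately show "z \<in> T" using V1 by blast
  qed
  let ?K = "closure W - ?O"
  have K: "compact ?K" using W O by (simp add: compact_diff)
  have "?K \<subseteq> - closure (- W)" using fO fW by auto
  then obtain V3 where V3: "open V3" "0 \<in> V3" "?K + V3 \<subseteq> - closure (- W)"
    using compact_plus_nbhd_subset_open[OF K] by (metis closed_closure open_Compl)
  \<comment> \<open>Symmetric, since both \<open>u\<close> and \<open>- u\<close> occur as moves
    below.\<close>
  define V where "V = (V2 \<inter> uminus -` V2) \<inter> (V3 \<inter> uminus -` V3)"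
  show thesis
  proof (rule that[of V])
    show "open V" unfolding V_def
      by (intro open_Int V2 V3 open_vimage continuous_intros)
    show "0 \<in> V" using V2 V3 by (auto simp: V_def)
    fix U assume U: "U \<subseteq> V"
    show "van_Hove_boundary U W \<subseteq> T"
    proof
      fix z assume "z \<in> van_Hove_boundary U W"
      then consider (1) "z \<in> U + closure W" "z \<in> closure (- W)" | (2) "z \<in> U + closure (- W)" "z \<in> closure W"
        by (auto simp: van_Hove_boundary_def)
      then show "z \<in> T"
      proof cases
        case 1
        then obtain u w where uw: "u \<in> U" "w \<in> closure W" "z = u + w" by (auto simp: set_plus_def)
        have "w \<in> ?O"
        proof (rule ccontr)
          assume "w \<notin> ?O"
          then have "w + u \<in> ?K + V3" using uw U by (auto simp: V_def intro!: set_plus_intro)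
          then show False using V3 1 uw by (auto simp: add.commute)
        qed
        then obtain x v where xv: "x \<in> frontier W" "v \<in> V2" "w = x + v" by (auto simp: elt_set_plus_def)
        have "v + u \<in> V1" using xv uw U by (intro V2') (auto simp: V_def)
        then have "x + (v + u) \<in> frontier W + V1" using xv by blast
        then show ?thesis using V1 uw xv by (auto simp: algebra_simps)
      next
        case 2
        then obtain u w where uw: "u \<in> U" "w \<in> closure (- W)" "z = u + w" by (auto simp: set_plus_def)
        have "z \<in> ?O"
        proof (rule ccontr)
          assume "z \<notin> ?O"
          then have "z + (- u) \<in> ?K + V3" using uw U 2 by (intro set_plus_intro) (auto simp: V_def)
          then show False using V3 uw by auto
        qed
        then show ?thesis using \<open>?O \<subseteq> T\<close> by auto
      qed
    qed
  qed
qed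

section \<open>Haar measures\<close>

lemma haar_measureD:
  assumes "haar_measure \<theta>"
  shows haar_measure_sets: "sets \<theta> = sets borel"
    and haar_measure_UNIV: "emeasure \<theta> UNIV \<noteq> 0"
    and haar_measure_translate: "B \<in> sets borel \<Longrightarrow> emeasure \<theta> (x +o B) = emeasure \<theta> B"
    and haar_measure_compact: "compact K \<Longrightarrow> emeasure \<theta> K < \<infinity>"
    and haar_measure_outer_regular:
      "B \<in> sets borel \<Longrightarrow> emeasure \<theta> B = (INF T\<in>{T. open T \<and> B \<subseteq> T}. emeasure \<theta> T)"
proof -
  note h = assms[unfolded haar_measure_def]
  note h1 = h[THEN conjunct2] note h2 = h1[THEN conjunct2] note h3 = h2[THEN conjunct2] note h4 = h3[THEN conjunct2]
  show "sets \<theta> = sets borel" by (rule h[THEN conjunct1])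
  show "emeasure \<theta> UNIV \<noteq> 0" by (rule h1[THEN conjunct1])
  show "B \<in> sets borel \<Longrightarrow> emeasure \<theta> (x +o B) = emeasure \<theta> B"
    by (rule h2[THEN conjunct1, rule_format])
  show "compact K \<Longrightarrow> emeasure \<theta> K < \<infinity>"
    by (rule h3[THEN conjunct1, rule_format])
  show "B \<in> sets borel \<Longrightarrow> emeasure \<theta> B = (INF T\<in>{T. open T \<and> B \<subseteq> T}. emeasure \<theta> T)"
    by (rule h4[THEN conjunct1, rule_format])
qed

lemma haar_measure_space: "haar_measure \<theta> \<Longrightarrow> space \<theta> = UNIV"
  using sets_eq_imp_space_eq[OF haar_measure_sets] by simp

lemma haar_measure_compact_fmeasurable:
  "haar_measure \<theta> \<Longrightarrow> compact K \<Longrightarrow> K \<in> fmeasurable \<theta>"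
  by (simp add: fmeasurable_def haar_measure_compact[simplified] haar_measure_sets borel_compact)

lemma haar_measure_translate_measure:
  "haar_measure \<theta> \<Longrightarrow> B \<in> sets borel \<Longrightarrow> measure \<theta> (x +o B) = measure \<theta> B"
  by (simp add: measure_def haar_measure_translate)

lemma haar_measure_mono:
  assumes "haar_measure \<theta>" "compact K" "closed S" "S \<subseteq> K"
  shows "measure \<theta> S \<le> measure \<theta> K"
  using assms haar_measure_compact_fmeasurable[of \<theta> K]
  by (intro measure_mono_fmeasurable) (auto simp: haar_measure_sets)

lemma haar_measure_outer_regular_compact:
  assumes "haar_measure \<theta>" "compact K" "e > 0"
  obtains T where "open T" "K \<subseteq> T" "T \<in> fmeasurable \<theta>" "measure \<theta> T < measure \<theta> K + e"
proof -
  have fin: "emeasure \<theta> K = ennreal (measure \<theta> K)"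
    using haar_measure_compact_fmeasurable[OF assms(1,2)] by (simp add: emeasure_eq_measure2)
  have "emeasure \<theta> K = (INF T\<in>{T. open T \<and> K \<subseteq> T}. emeasure \<theta> T)"
    using assms by (intro haar_measure_outer_regular borel_compact)
  moreover have "emeasure \<theta> K < ennreal (measure \<theta> K + e)"
    using assms fin by (simp add: ennreal_less_iff)
  ultimately obtain T where T: "open T" "K \<subseteq> T" "emeasure \<theta> T < ennreal (measure \<theta> K + e)"
    by (auto simp: INF_less_iff)
  have "T \<in> fmeasurable \<theta>"
    using T assms(1) less_trans[OF T(3) ennreal_less_top] by (simp add: fmeasurable_def haar_measure_sets)
  moreover from this have "measure \<theta> T < measure \<theta> K + e"
    using T by (simp add: emeasure_eq_measure2 ennreal_less_iff del: ennreal_plus)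
  ultimately show thesis using T that by blast
qed

lemma haar_measure_pos_compact:
  fixes \<theta> :: "'a::{topological_ab_group_add, t2_space} measure"
  assumes "sigma_compact_lc_group TYPE('a)" "haar_measure \<theta>"
  obtains K where "compact K" "emeasure \<theta> K \<noteq> 0"
proof (rule ccontr)
  note K = that
  assume "\<not> thesis"
  then have *: "emeasure \<theta> K = 0" if "compact K" for K using K that by blast
  obtain K :: "nat \<Rightarrow> 'a set" where K: "\<And>n. compact (K n)" "(\<Union>n. K n) = UNIV"
    using assms(1) by (auto simp: sigma_compact_lc_group_def)
  have "emeasure \<theta> (\<Union>n. K n) = 0"
    using K assms by (intro emeasure_UN_eq_0 *) (auto simp: haar_measure_sets borel_compact)
  then show False using K haar_measure_UNIV[OF assms(2)] by simp
qed

lemma haar_measure_sigma_finite: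
  fixes \<theta> :: "'a::{topological_ab_group_add, t2_space} measure"
  assumes "sigma_compact_lc_group TYPE('a)" "haar_measure \<theta>"
  shows "sigma_finite_measure \<theta>"
proof -
  obtain K :: "nat \<Rightarrow> 'a set" where K: "\<And>n. compact (K n)" "(\<Union>n. K n) = UNIV"
    using assms(1) by (auto simp: sigma_compact_lc_group_def)
  show ?thesis
  proof (unfold_locales, intro exI[of _ "range K"] conjI ballI)
    show "range K \<subseteq> sets \<theta>" using K assms by (auto simp: haar_measure_sets borel_compact)
    show "\<Union> (range K) = space \<theta>" using K assms by (auto simp: haar_measure_space)
    fix a assume "a \<in> range K"
    then have "compact a" using K by auto
    then show "emeasure \<theta> a \<noteq> \<infinity>" using haar_measure_compact[OF assms(2)] by fastforce
  qed auto
qed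

section \<open>Translation invariance of Haar measures and of their product\<close>

lemma haar_measure_distr_translate:
  fixes \<theta> :: "'a::{topological_ab_group_add, t2_space} measure"
  assumes "haar_measure \<theta>"
  shows "(+) a \<in> measurable \<theta> \<theta>" "distr \<theta> \<theta> ((+) a) = \<theta>"
proof -
  have "(+) a \<in> borel_measurable borel"
    by (intro borel_measurable_continuous_onI continuous_intros)
  then show m: "(+) a \<in> measurable \<theta> \<theta>"
    using haar_measure_sets[OF assms] measurable_cong_sets by blast
  show "distr \<theta> \<theta> ((+) a) = \<theta>"
  proof (rule measure_eqI)
    fix B assume "B \<in> sets (distr \<theta> \<theta> ((+) a))"
    then have B: "B \<in> sets \<theta>" by simp
    have "(+) a -` B = (- a) +o B" by (auto simp: elt_set_plus_eq_vimage add.commute)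
    then show "emeasure (distr \<theta> \<theta> ((+) a)) B = emeasure \<theta> B"
      using assms B m haar_measure_translate[OF assms, of B "-a"]
      by (simp add: emeasure_distr haar_measure_space haar_measure_sets)
  qed simp
qed

text \<open>Each factor is its own image measure under translations, hence so is the product. The
  map shifts by \<open>- z\<close> because its preimages are then translates by
  \<open>z\<close>.\<close>

lemma haar_product_translate:
  fixes \<theta>G :: "'g::{topological_ab_group_add, t2_space} measure"
    and \<theta>H :: "'h::{topological_ab_group_add, t2_space} measure"
  assumes "haar_measure \<theta>G" "haar_measure \<theta>H" "sigma_finite_measure \<theta>H"
    and B: "B \<in> sets (\<theta>G \<Otimes>\<^sub>M \<theta>H)"
  shows "z +o B \<in> sets (\<theta>G \<Otimes>\<^sub>M \<theta>H)"
    and "emeasure (\<theta>G \<Otimes>\<^sub>M \<theta>H) (z +o B) = emeasure (\<theta>G \<Otimes>\<^sub>M \<theta>H) B"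
proof -
  let ?M = "\<theta>G \<Otimes>\<^sub>M \<theta>H"
  let ?f = "\<lambda>(x, y). (fst (- z) + x, snd (- z) + y)"
  have eq: "z +o B = ?f -` B \<inter> space ?M"
    using assms(1,2) by (auto simp: elt_set_plus_eq_vimage space_pair_measure haar_measure_space minus_prod_def)
  have m: "?f \<in> measurable ?M ?M"
    unfolding split_beta
    by (intro measurable_Pair measurable_compose[OF measurable_fst haar_measure_distr_translate(1)]
        measurable_compose[OF measurable_snd haar_measure_distr_translate(1)] assms)
  show "z +o B \<in> sets ?M" using m B unfolding eq by (rule measurable_sets)
  have "?M = distr ?M ?M ?f"
    using pair_measure_distr[OF haar_measure_distr_translate(1) haar_measure_distr_translate(1), OF assms(1,2)]
      haar_measure_distr_translate(2)[OF assms(1)] haar_measure_distr_translate(2)[OF assms(2)] assms(3)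
    by metis
  then have "emeasure ?M B = emeasure (distr ?M ?M ?f) B" by simp
  also have "\<dots> = emeasure ?M (z +o B)" unfolding eq using m B by (rule emeasure_distr)
  finally show "emeasure ?M (z +o B) = emeasure ?M B" by simp
qed

section \<open>Growth of measure along van Hove sequences\<close>

lemma haar_measure_plus_le:
  assumes "haar_measure \<theta>" "compact A" "compact C"
  shows "measure \<theta> (A + C) \<le> measure \<theta> A + measure \<theta> (van_Hove_boundary C A)"
proof -
  have cA: "closure A = A" using assms by (simp add: compact_imp_closed closure_closed)
  \<comment> \<open>A point of \<open>A + C\<close> outside \<open>A\<close> lies in
    \<open>C + closure A\<close> and in \<open>- A\<close>, hence in the first half of the
    boundary.\<close>
  have "A + C \<subseteq> A \<union> van_Hove_boundary C A"
  proof
    fix z assume z: "z \<in> A + C"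
    then have "z \<in> C + closure A" unfolding cA by (simp add: add.commute)
    then show "z \<in> A \<union> van_Hove_boundary C A"
      using closure_subset[of "-A"] by (auto simp: van_Hove_boundary_def)
  qed
  moreover have K: "compact (van_Hove_boundary C A)"
    using assms cA by (intro compact_van_Hove_boundary) auto
  ultimately have "measure \<theta> (A + C) \<le> measure \<theta> (A \<union> van_Hove_boundary C A)"
    using assms by (intro haar_measure_mono compact_Un compact_imp_closed compact_set_plus) auto
  also have "\<dots> \<le> measure \<theta> A + measure \<theta> (van_Hove_boundary C A)"
    using assms K haar_measure_compact_fmeasurable[OF assms(1)] by (intro measure_Un_le) (auto intro: fmeasurableD)
  finally show ?thesis .
qed

text \<open>Non-compactness leaves some \<open>x\<close> outside the compact set
  \<open>K - C\<close>, and then \<open>x + C\<close> is disjoint from \<open>K\<close>; iterating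
  piles up disjoint translates of \<open>C\<close>.\<close>

lemma haar_measure_disjoint_translates:
  fixes C :: "'a::{topological_ab_group_add, t2_space} set"
  assumes "haar_measure \<theta>" "compact C" "\<not> compact (UNIV :: 'a set)"
  shows "\<exists>K. compact K \<and> measure \<theta> K \<ge> real k * measure \<theta> C"
proof (induction k)
  case 0
  show ?case by (rule exI[of _ "{}"]) auto
next
  case (Suc k)
  then obtain K where K: "compact K" "measure \<theta> K \<ge> real k * measure \<theta> C" by blast
  have "compact (K + uminus ` C)"
    using assms K by (intro compact_set_plus compact_continuous_image continuous_intros)
  then have "K + uminus ` C \<noteq> UNIV" using assms(3) by auto
  then obtain x where x: "x \<notin> K + uminus ` C" by auto
  have disj: "K \<inter> (x +o C) = {}"
  proof (rule ccontr)
    assume "\<not> ?thesis"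
    then obtain c where "c \<in> C" "x + c \<in> K" by (auto simp: elt_set_plus_def)
    then have "(x + c) + - c \<in> K + uminus ` C" by blast
    then show False using x by simp
  qed
  have c: "compact (x +o C)" using assms by (intro compact_elt_set_plus)
  have "measure \<theta> (K \<union> (x +o C)) = measure \<theta> K + measure \<theta> (x +o C)"
    using haar_measure_compact_fmeasurable[OF assms(1) K(1)] haar_measure_compact_fmeasurable[OF assms(1) c] disj
    by (intro measure_Un3[THEN trans]) (auto simp: disj)
  also have "measure \<theta> (x +o C) = measure \<theta> C"
    using assms by (intro haar_measure_translate_measure borel_compact)
  finally have "measure \<theta> (K \<union> (x +o C)) \<ge> real (Suc k) * measure \<theta> C"
    using K by (simp add: algebra_simps)
  then show ?case using K c by (intro exI[of _ "K \<union> (x +o C)"]) auto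
qed

text \<open>Translates of \<open>A 0\<close> build a compact \<open>K\<close> of measure at least
  \<open>2 * Z\<close>. Once the \<open>K\<close>-boundary of \<open>A n\<close> has less measure
  than \<open>A n\<close>, a translate of \<open>K\<close> fits into \<open>A n + K\<close>, whose
  measure is at most twice that of \<open>A n\<close>.\<close>

lemma van_Hove_measure_at_top:
  fixes A :: "nat \<Rightarrow> 'a::{topological_ab_group_add, t2_space} set"
  assumes haar: "haar_measure \<theta>" and vH: "van_Hove_sequence \<theta> A" and nc: "\<not> compact (UNIV :: 'a set)"
  shows "filterlim (\<lambda>n. measure \<theta> (A n)) at_top sequentially"
  unfolding filterlim_at_top
proof
  fix Z :: real
  have A: "compact (A n)" "measure \<theta> (A n) > 0" for n using vH by (auto simp: van_Hove_sequence_def)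
  obtain k :: nat where k: "real k * measure \<theta> (A 0) \<ge> 2 * Z"
    using reals_Archimedean3[OF A(2)[of 0]] by (metis less_imp_le)
  obtain K where K: "compact K" "measure \<theta> K \<ge> 2 * Z"
    using haar_measure_disjoint_translates[OF haar A(1)[of 0] nc, of k] k by force
  have "(\<lambda>n. measure \<theta> (van_Hove_boundary K (A n)) / measure \<theta> (A n)) \<longlonglongrightarrow> 0"
    using vH K by (auto simp: van_Hove_sequence_def)
  then have "\<forall>\<^sub>F n in sequentially. measure \<theta> (van_Hove_boundary K (A n)) / measure \<theta> (A n) < 1"
    by (rule order_tendstoD) simp
  then show "\<forall>\<^sub>F n in sequentially. Z \<le> measure \<theta> (A n)"
  proof eventually_elim
    case (elim n)
    obtain a where a: "a \<in> A n" using A(2)[of n] by fastforce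
    have "measure \<theta> K = measure \<theta> (a +o K)" using haar_measure_translate_measure[OF haar] K by (simp add: borel_compact)
    also have "\<dots> \<le> measure \<theta> (A n + K)"
      using a A K by (intro haar_measure_mono[OF haar] compact_set_plus compact_imp_closed
          compact_elt_set_plus set_plus_mono3)
    also have "\<dots> \<le> measure \<theta> (A n) + measure \<theta> (van_Hove_boundary K (A n))"
      by (intro haar_measure_plus_le haar A K)
    also have "\<dots> \<le> 2 * measure \<theta> (A n)" using elim A(2)[of n] by (simp add: field_simps)
    finally show ?case using K by simp
  qed
qed

section \<open>Fundamental domains\<close>

text \<open>Serves to cut a fundamental domain into disjoint measurable pieces indexed by lattice
  vectors; each new set gives up what the earlier ones cover.\<close>

lemma disjoint_refinement_finite:
  assumes "finite E" "\<And>e. e \<in> E \<Longrightarrow> T e \<in> sets M"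
  shows "\<exists>Q. (\<forall>e\<in>E. Q e \<in> sets M \<and> Q e \<subseteq> T e) \<and> disjoint_family_on Q E \<and> \<Union> (Q ` E) = \<Union> (T ` E)"
  using assms
proof (induction E)
  case empty
  show ?case by (auto simp: disjoint_family_on_def)
next
  case (insert e E)
  then obtain Q where Q: "\<And>e. e \<in> E \<Longrightarrow> Q e \<in> sets M \<and> Q e \<subseteq> T e" "disjoint_family_on Q E" "\<Union> (Q ` E) = \<Union> (T ` E)"
    by auto
  define Q' where "Q' = Q(e := T e - \<Union> (T ` E))"
  have im: "Q' ` E = Q ` E" using insert by (auto simp: Q'_def)
  have "\<forall>x\<in>insert e E. Q' x \<in> sets M \<and> Q' x \<subseteq> T x"
    using Q(1) insert.hyps insert.prems sets.finite_UN[of E T M] by (auto simp: Q'_def)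
  moreover have "disjoint_family_on Q' (insert e E)"
    using Q(1,2) insert(2) by (fastforce simp: Q'_def disjoint_family_on_def)
  moreover have "\<Union> (Q' ` insert e E) = Q' e \<union> \<Union> (Q ` E)" using im by simp
  then have "\<Union> (Q' ` insert e E) = \<Union> (T ` insert e E)"
    unfolding Q(3) by (auto simp: Q'_def)
  ultimately show ?case by blast
qed

lemma finite_subsingleton:
  assumes "\<And>x y. x \<in> S \<Longrightarrow> y \<in> S \<Longrightarrow> x = y"
  shows "finite S"
proof (cases "S = {}")
  case False
  then obtain x where "x \<in> S" by blast
  then have "S \<subseteq> {x}" using assms by blast
  then show ?thesis by (rule finite_subset) simp
qed simp

text \<open>A set of this family is determined by its trace on \<open>Z\<close>; this is the source
  of the powers of 2 in the entropy bound.\<close>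

lemma sets_agreeing_off_finite:
  assumes "finite Z"
  shows "finite {Y. Y - Z = X - Z}" "card {Y. Y - Z = X - Z} \<le> 2 ^ card Z"
proof -
  have sub: "{Y. Y - Z = X - Z} \<subseteq> (\<lambda>Y. (X - Z) \<union> Y) ` Pow Z"
  proof
    fix Y assume "Y \<in> {Y. Y - Z = X - Z}"
    then have "Y = (X - Z) \<union> (Y \<inter> Z)" by blast
    then show "Y \<in> (\<lambda>Y. (X - Z) \<union> Y) ` Pow Z" by blast
  qed
  have fin: "finite ((\<lambda>Y. (X - Z) \<union> Y) ` Pow Z)" using assms by simp
  show "finite {Y. Y - Z = X - Z}" using sub fin by (rule finite_subset)
  have "card {Y. Y - Z = X - Z} \<le> card ((\<lambda>Y. (X - Z) \<union> Y) ` Pow Z)" using fin sub by (rule card_mono)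
  also have "\<dots> \<le> card (Pow Z)" using assms by (intro card_image_le) simp
  also have "\<dots> = 2 ^ card Z" using assms by (rule card_Pow)
  finally show "card {Y. Y - Z = X - Z} \<le> 2 ^ card Z" .
qed

section \<open>Lattices and the existence of fundamental domains\<close>

locale cut_and_project =
  fixes \<L> :: "('g::{topological_ab_group_add, t2_space} \<times> 'h::{topological_ab_group_add, t2_space}) set"
    and \<theta>G :: "'g measure" and \<theta>H :: "'h measure"
  assumes scheme: "cut_and_project_scheme \<L>"
    and haar_G: "haar_measure \<theta>G" and haar_H: "haar_measure \<theta>H"
begin

lemma sigma_compact_G: "sigma_compact_lc_group TYPE('g)"
  and sigma_compact_H: "sigma_compact_lc_group TYPE('h)"
  and lattice_zero: "0 \<in> \<L>"
  and lattice_add: "x \<in> \<L> \<Longrightarrow> y \<in> \<L> \<Longrightarrow> x + y \<in> \<L>"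
  and lattice_uminus: "x \<in> \<L> \<Longrightarrow> - x \<in> \<L>"
  and lattice_discrete: "discrete \<L>"
  and lattice_cocompact: "compact_space (quotient_topology \<L>)"
  and inj_on_fst: "inj_on fst \<L>"
  and dense_snd: "closure (snd ` \<L>) = UNIV"
  using scheme unfolding cut_and_project_scheme_def by blast+

lemma lattice_diff: "x \<in> \<L> \<Longrightarrow> y \<in> \<L> \<Longrightarrow> x - y \<in> \<L>"
  using lattice_add[OF _ lattice_uminus, of x y] by simp

lemma lattice_add_iff: "y \<in> \<L> \<Longrightarrow> x + y \<in> \<L> \<longleftrightarrow> x \<in> \<L>"
  using lattice_add[of x y] lattice_diff[of "x + y" y] by auto

lemma sigma_finite_H: "sigma_finite_measure \<theta>H"
  by (rule haar_measure_sigma_finite[OF sigma_compact_H haar_H])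

text \<open>Discreteness at 0 provides a box whose differences meet \<open>\<L>\<close> only in 0.
  Since only differences matter, every translate of the box contains at most one point of each coset
  of \<open>\<L>\<close>.\<close>

lemma separating_box:
  obtains V1 V2 where "open V1" "open V2" "0 \<in> V1" "0 \<in> V2"
    "compact (closure V1)" "compact (closure V2)"
    "\<forall>c x y. x \<in> (fst c +o V1) \<times> (snd c +o V2) \<longrightarrow> y \<in> (fst c +o V1) \<times> (snd c +o V2) \<longrightarrow> x - y \<in> \<L> \<longrightarrow> x = y"
proof -
  obtain T where T: "open T" "T \<inter> \<L> = {0}"
    using lattice_discrete lattice_zero by (auto simp: discrete_def isolated_in_def)
  then obtain A B where AB: "open A" "open B" "(0,0) \<in> A \<times> B" "A \<times> B \<subseteq> T"
    using open_prod_elim[of T "(0,0)"] by (metis IntD1 singletonI zero_prod_def)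
  obtain A' where A': "open A'" "0 \<in> A'" "\<And>x y. x \<in> A' \<Longrightarrow> y \<in> A' \<Longrightarrow> x - y \<in> A"
    using open_zero_diff[of A] AB by auto
  obtain B' where B': "open B'" "0 \<in> B'" "\<And>x y. x \<in> B' \<Longrightarrow> y \<in> B' \<Longrightarrow> x - y \<in> B"
    using open_zero_diff[of B] AB by auto
  obtain V1 where V1: "open V1" "0 \<in> V1" "V1 \<subseteq> A'" "compact (closure V1)"
    using compact_closure_nbhd_zero[OF sigma_compact_G A'(1,2)] by blast
  obtain V2 where V2: "open V2" "0 \<in> V2" "V2 \<subseteq> B'" "compact (closure V2)"
    using compact_closure_nbhd_zero[OF sigma_compact_H B'(1,2)] by blast
  show thesis
  proof (rule that[OF V1(1) V2(1) V1(2) V2(2) V1(4) V2(4)], intro allI impI)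
    fix c x y assume x: "x \<in> (fst c +o V1) \<times> (snd c +o V2)" and y: "y \<in> (fst c +o V1) \<times> (snd c +o V2)"
      and l: "x - y \<in> \<L>"
    obtain x1 y1 where 1: "x1 \<in> V1" "y1 \<in> V1" "fst x = fst c + x1" "fst y = fst c + y1"
      using x y by (auto simp: elt_set_plus_def)
    obtain x2 y2 where 2: "x2 \<in> V2" "y2 \<in> V2" "snd x = snd c + x2" "snd y = snd c + y2"
      using x y by (auto simp: elt_set_plus_def)
    have "x1 - y1 \<in> A" using 1 V1(3) A'(3) by auto
    moreover have "x2 - y2 \<in> B" using 2 V2(3) B'(3) by auto
    ultimately have "x - y \<in> A \<times> B" using 1 2 by (simp add: mem_Times_iff)
    then have "x - y \<in> T \<inter> \<L>" using l by (intro IntI subsetD[OF AB(4)])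
    then have "x - y = 0" unfolding T(2) by simp
    then show "x = y" by simp
  qed
qed

text \<open>Finitely many translates of a separating box cover \<open>C1 \<times> C2\<close>, and
  each contains \<open>l + \<eta>\<close> for at most one \<open>l\<close>.\<close>

lemma finite_lattice_box:
  assumes "compact C1" "compact C2"
  shows "finite {l \<in> \<L>. l + \<eta> \<in> C1 \<times> C2}"
proof -
  obtain V1 V2 where V: "open V1" "open V2" "0 \<in> V1" "0 \<in> V2"
    "compact (closure V1)" "compact (closure V2)"
    "\<forall>c x y. x \<in> (fst c +o V1) \<times> (snd c +o V2) \<longrightarrow> y \<in> (fst c +o V1) \<times> (snd c +o V2) \<longrightarrow> x - y \<in> \<L> \<longrightarrow> x = y"
    by (rule separating_box)
  have "C1 \<subseteq> (\<Union>c\<in>C1. c +o V1)" using V(3) set_plus_intro2[of 0 V1] by force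
  then obtain X1 where X1: "finite X1" "C1 \<subseteq> (\<Union>c\<in>X1. c +o V1)"
    by (rule compactE_image[OF assms(1) open_elt_set_plus[OF V(1)]])
  have "C2 \<subseteq> (\<Union>c\<in>C2. c +o V2)" using V(4) set_plus_intro2[of 0 V2] by force
  then obtain X2 where X2: "finite X2" "C2 \<subseteq> (\<Union>c\<in>X2. c +o V2)"
    by (rule compactE_image[OF assms(2) open_elt_set_plus[OF V(2)]])
  let ?S = "\<lambda>c. {l \<in> \<L>. l + \<eta> \<in> (fst c +o V1) \<times> (snd c +o V2)}"
  have "finite (?S c)" for c
  proof -
    have sep: "l = l'" if "l \<in> ?S c" "l' \<in> ?S c" for l l'
    proof -
      have "l + \<eta> - (l' + \<eta>) \<in> \<L>" using that lattice_diff[of l l'] by simp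
      then have "l + \<eta> = l' + \<eta>" using that V(7)[rule_format, of "l + \<eta>" c "l' + \<eta>"] by simp
      then show ?thesis by simp
    qed
    show ?thesis by (rule finite_subsingleton[OF sep])
  qed
  moreover have "{l \<in> \<L>. l + \<eta> \<in> C1 \<times> C2} \<subseteq> (\<Union>c\<in>X1 \<times> X2. ?S c)"
  proof
    fix l assume l: "l \<in> {l \<in> \<L>. l + \<eta> \<in> C1 \<times> C2}"
    then have "fst (l + \<eta>) \<in> C1" "snd (l + \<eta>) \<in> C2" by (simp_all add: mem_Times_iff)
    then obtain c1 c2 where "c1 \<in> X1" "c2 \<in> X2" "fst (l + \<eta>) \<in> c1 +o V1" "snd (l + \<eta>) \<in> c2 +o V2"
      using X1(2) X2(2) by blast
    then show "l \<in> (\<Union>c\<in>X1 \<times> X2. ?S c)" using l by (intro UN_I[of "(c1, c2)"]) (auto simp: mem_Times_iff)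
  qed
  moreover have "finite (X1 \<times> X2)" using X1(1) X2(1) by simp
  ultimately show ?thesis by (metis (no_types, lifting) finite_UN_I finite_subset)
qed

text \<open>Countability keeps unions over the lattice inside the product \<sigma>-algebra and makes
  countable additivity applicable to them.\<close>

lemma countable_lattice: "countable \<L>"
proof -
  obtain K1 :: "nat \<Rightarrow> 'g set" where K1: "\<And>n. compact (K1 n)" "(\<Union>n. K1 n) = UNIV"
    using sigma_compact_G by (auto simp: sigma_compact_lc_group_def)
  obtain K2 :: "nat \<Rightarrow> 'h set" where K2: "\<And>n. compact (K2 n)" "(\<Union>n. K2 n) = UNIV"
    using sigma_compact_H by (auto simp: sigma_compact_lc_group_def)
  have "\<L> \<subseteq> (\<Union>m. \<Union>n. {l \<in> \<L>. l + 0 \<in> K1 m \<times> K2 n})"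
  proof
    fix l assume "l \<in> \<L>"
    moreover obtain m where "fst l \<in> K1 m" using K1(2) by blast
    moreover obtain n where "snd l \<in> K2 n" using K2(2) by blast
    ultimately show "l \<in> (\<Union>m. \<Union>n. {l \<in> \<L>. l + 0 \<in> K1 m \<times> K2 n})" by (auto simp: mem_Times_iff)
  qed
  moreover have "countable (\<Union>m. \<Union>n. {l \<in> \<L>. l + 0 \<in> K1 m \<times> K2 n})"
    by (intro countable_UN countable_finite[OF finite_lattice_box] K1 K2) auto
  ultimately show ?thesis by (rule countable_subset)
qed

abbreviation haar_product :: "('g \<times> 'h) measure"  where "haar_product \<equiv> \<theta>G \<Otimes>\<^sub>M \<theta>H"

lemmas product_translate = haar_product_translate[OF haar_G haar_H sigma_finite_H]

lemma Times_in_sets: "R \<in> sets borel \<Longrightarrow> P \<in> sets borel \<Longrightarrow> R \<times> P \<in> sets haar_product"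
  using haar_measure_sets[OF haar_G] haar_measure_sets[OF haar_H] by auto

lemma emeasure_Times:
  "R \<in> sets borel \<Longrightarrow> P \<in> sets borel \<Longrightarrow> emeasure haar_product (R \<times> P) = emeasure \<theta>G R * emeasure \<theta>H P"
  using haar_measure_sets[OF haar_G] haar_measure_sets[OF haar_H] sigma_finite_H
  by (intro sigma_finite_measure.emeasure_pair_measure_Times) auto

lemma lattice_saturation_in_sets:
  assumes "F \<in> sets haar_product"
  shows "(\<Union>l\<in>\<L>. l +o F) \<in> sets haar_product"
  by (intro sets.countable_UN'' countable_lattice product_translate assms)

text \<open>Cocompactness made concrete: the images of open boxes are open in the quotient and cover
  it, so finitely many boxes meet every coset.\<close>

lemma finite_covering_boxes:
  assumes "open V1" "open V2" "0 \<in> V1" "0 \<in> V2"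
  obtains P where "finite P" "\<And>x. \<exists>p\<in>P. \<exists>l\<in>\<L>. l + x \<in> (fst p +o V1) \<times> (snd p +o V2)"
proof -
  define B where "B p = (fst p +o V1) \<times> (snd p +o V2)" for p
  define q where "q x = x +o \<L>" for x
  have q_eq: "q = (\<lambda>x. x +o \<L>)" by (simp add: q_def fun_eq_iff)
  have qeq: "q x = q y \<longleftrightarrow> x - y \<in> \<L>" for x y
  proof
    assume "q x = q y"
    moreover have "x \<in> q x" using set_plus_intro2[OF lattice_zero, of x] by (simp add: q_def)
    ultimately show "x - y \<in> \<L>" by (simp add: q_def set_minus_plus)
  next
    assume xy: "x - y \<in> \<L>"
    have "z - x \<in> \<L> \<longleftrightarrow> z - y \<in> \<L>" for z
      using lattice_add_iff[OF xy, of "z - x"] by simp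
    then show "q x = q y" by (auto simp: q_def set_minus_plus[symmetric])
  qed
  \<comment> \<open>The saturation of a box is a union of translated boxes, which makes the image of
    the box open in the quotient topology.\<close>
  have vim: "q -` (q ` B p) = (\<Union>l\<in>\<L>. B (p - l))" for p
  proof -
    have "x \<in> q -` (q ` B p) \<longleftrightarrow> (\<exists>l\<in>\<L>. l + x \<in> B p)" for x
    proof -
      have "x \<in> q -` (q ` B p) \<longleftrightarrow> (\<exists>b\<in>B p. b - x \<in> \<L>)" using qeq lattice_uminus by (metis image_iff vimage_eq)
      also have "\<dots> \<longleftrightarrow> (\<exists>l\<in>\<L>. l + x \<in> B p)" by (metis add_diff_cancel_right' diff_add_cancel)
      finally show ?thesis .
    qed
    moreover have "l + x \<in> B p \<longleftrightarrow> x \<in> B (p - l)" for l x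
      by (simp add: B_def mem_Times_iff set_minus_plus[symmetric] algebra_simps)
    ultimately show ?thesis by blast
  qed
  have opB: "open (B p)" for p unfolding B_def by (intro open_Times open_elt_set_plus assms)
  have op: "openin (quotient_topology \<L>) (q ` B p)" for p
    unfolding openin_quotient_topology q_eq[symmetric] vim by (intro conjI image_mono subset_UNIV open_UN ballI opB)
  have top: "topspace (quotient_topology \<L>) = range q"
    using quotient_imp_surjective_map[OF quotient_map_quotient_topology, of \<L>] by (simp add: q_eq)
  have pB: "p \<in> B p" for p
    using assms set_plus_intro2[of 0 V1 "fst p"] set_plus_intro2[of 0 V2 "snd p"] by (simp add: B_def mem_Times_iff)
  have "compactin (quotient_topology \<L>) (range q)"
    using lattice_cocompact by (simp add: compact_space_def top)
  moreover have "range q \<subseteq> \<Union> (range (\<lambda>p. q ` B p))" using pB by blast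
  ultimately obtain \<F> where \<F>: "finite \<F>" "\<F> \<subseteq> range (\<lambda>p. q ` B p)" "range q \<subseteq> \<Union> \<F>"
    unfolding compactin_def using op by (metis (no_types, lifting) rangeE)
  obtain P where P: "finite P" "\<F> = (\<lambda>p. q ` B p) ` P"
    using finite_subset_image[OF \<F>(1,2)] by blast
  show thesis
  proof (rule that[OF P(1)])
    fix x
    obtain p where p: "p \<in> P" "q x \<in> q ` B p" using \<F>(3) P(2) by blast
    then have "x \<in> q -` (q ` B p)" by simp
    then obtain l where "l \<in> \<L>" "x \<in> B (p - l)" unfolding vim by blast
    then have "l + x \<in> B p" by (simp add: B_def mem_Times_iff set_minus_plus[symmetric] algebra_simps)
    with p(1) \<open>l \<in> \<L>\<close> show "\<exists>p\<in>P. \<exists>l\<in>\<L>. l + x \<in> (fst p +o V1) \<times> (snd p +o V2)"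
      unfolding B_def[symmetric] by (intro bexI)
  qed
qed

text \<open>Induction over finitely many separating boxes: from each new box only the points whose
  coset has no representative yet are added. Existence gives the choice inside \<open>dens\<close>
  its meaning.\<close>

lemma ex_fundamental_domain: "\<exists>F. fundamental_domain \<theta>G \<theta>H \<L> F"
proof -
  obtain V1 V2 where V: "open V1" "open V2" "0 \<in> V1" "0 \<in> V2"
    "compact (closure V1)" "compact (closure V2)"
    "\<forall>c x y. x \<in> (fst c +o V1) \<times> (snd c +o V2) \<longrightarrow> y \<in> (fst c +o V1) \<times> (snd c +o V2) \<longrightarrow> x - y \<in> \<L> \<longrightarrow> x = y"
    by (rule separating_box)
  define B where "B p = (fst p +o V1) \<times> (snd p +o V2)" for p
  have BL: "x = y" if "x \<in> B p" "y \<in> B p" "x - y \<in> \<L>" for p x y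
    using V(7)[rule_format, of x p y] that by (simp add: B_def)
  obtain P where P: "finite P" "\<And>x. \<exists>p\<in>P. \<exists>l\<in>\<L>. l + x \<in> B p"
    using finite_covering_boxes[OF V(1-4)] unfolding B_def by metis
  have Bs: "B p \<in> sets haar_product" for p
    unfolding B_def by (intro Times_in_sets borel_open open_elt_set_plus V)
  \<comment> \<open>Invariant: a measurable set with exactly one representative of every coset that
    meets the boxes treated so far.\<close>
  have "\<exists>F\<in>sets haar_product. F \<subseteq> \<Union> (B ` P) \<and> (\<forall>x\<in>F. \<forall>y\<in>F. x - y \<in> \<L> \<longrightarrow> x = y) \<and>
    (\<forall>b\<in>\<Union> (B ` P). \<exists>y\<in>F. b - y \<in> \<L>)"
    using P(1)
  proof (induction P)
    case empty
    show ?case by (intro bexI[of _ "{}"]) auto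
  next
    case (insert p P)
    then obtain F where F: "F \<in> sets haar_product" "F \<subseteq> \<Union> (B ` P)"
       "\<And>x y. x \<in> F \<Longrightarrow> y \<in> F \<Longrightarrow> x - y \<in> \<L> \<Longrightarrow> x = y" "\<And>b. b \<in> \<Union> (B ` P) \<Longrightarrow> \<exists>y\<in>F. b - y \<in> \<L>" by metis
    define S where "S = (\<Union>l\<in>\<L>. l +o F)"
    have S: "x \<in> S \<longleftrightarrow> (\<exists>y\<in>F. x - y \<in> \<L>)" for x
    proof -
      have "x \<in> S \<longleftrightarrow> (\<exists>l\<in>\<L>. \<exists>y\<in>F. x = l + y)" by (auto simp: S_def elt_set_plus_def)
      also have "\<dots> \<longleftrightarrow> (\<exists>y\<in>F. x - y \<in> \<L>)" by (metis add_diff_cancel_right' diff_add_cancel)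
      finally show ?thesis .
    qed
    have Ss: "S \<in> sets haar_product" unfolding S_def by (intro lattice_saturation_in_sets F)
    show ?case
    proof (intro bexI[of _ "F \<union> (B p - S)"] conjI ballI impI)
      show "F \<union> (B p - S) \<in> sets haar_product" using F Ss Bs by auto
      show "F \<union> (B p - S) \<subseteq> \<Union> (B ` insert p P)" using F by auto
      fix x y assume x: "x \<in> F \<union> (B p - S)" and y: "y \<in> F \<union> (B p - S)" and l: "x - y \<in> \<L>"
      have l': "y - x \<in> \<L>" using lattice_uminus[OF l] by simp
      show "x = y" using x y l l' F(3) S BL by blast
    next
      fix b assume "b \<in> \<Union> (B ` insert p P)"
      then consider "b \<in> \<Union> (B ` P)" | "b \<in> B p" "b \<in> S" | "b \<in> B p" "b \<notin> S" by auto
      then show "\<exists>y\<in>F \<union> (B p - S). b - y \<in> \<L>"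
      proof cases
        case 3 then show ?thesis using lattice_zero by (intro bexI[of _ b]) auto
      qed (use F(4) S in blast)+
    qed
  qed
  then obtain F where F: "F \<in> sets haar_product" "F \<subseteq> \<Union> (B ` P)"
       "\<And>x y. x \<in> F \<Longrightarrow> y \<in> F \<Longrightarrow> x - y \<in> \<L> \<Longrightarrow> x = y" "\<And>b. b \<in> \<Union> (B ` P) \<Longrightarrow> \<exists>y\<in>F. b - y \<in> \<L>" by metis
  have "fundamental_domain \<theta>G \<theta>H \<L> F"
    unfolding fundamental_domain_def
  proof (intro conjI allI)
    let ?C = "\<Union>p\<in>P. (fst p +o closure V1) \<times> (snd p +o closure V2)"
    have C: "compact ?C"
      using P(1) V by (intro compact_UN compact_Times compact_elt_set_plus ballI)
    have "F \<subseteq> ?C"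
    proof -
      have "B p \<subseteq> (fst p +o closure V1) \<times> (snd p +o closure V2)" for p
        unfolding B_def by (intro Sigma_mono set_plus_mono closure_subset)
      then have "\<Union> (B ` P) \<subseteq> ?C" by (intro UN_mono order_refl)
      with F(2) show ?thesis by (rule order_trans)
    qed
    then have sub: "closure F \<subseteq> ?C" using C by (intro closure_minimal compact_imp_closed)
    show "relatively_compact F"
      using closed_Int_compact[OF closed_closure C, of F] unfolding relatively_compact_def Int_absorb2[OF sub] .
  next
    fix x
    obtain p l where "p \<in> P" "l \<in> \<L>" "l + x \<in> B p" using P(2) by metis
    have "l + x \<in> \<Union> (B ` P)" using \<open>p \<in> P\<close> \<open>l + x \<in> B p\<close> by (rule UN_I)
    then obtain y where y: "y \<in> F" "(l + x) - y \<in> \<L>" using F(4) by blast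
    have xy: "x - y \<in> \<L>" using lattice_diff[OF y(2) \<open>l \<in> \<L>\<close>] by (simp add: algebra_simps)
    show "\<exists>!y. y \<in> F \<and> x - y \<in> \<L>"
    proof (intro ex1I[of _ y] conjI y xy)
      fix z assume z: "z \<in> F \<and> x - z \<in> \<L>"
      have "z - y \<in> \<L>" using lattice_diff[OF xy, of "x - z"] z by simp
      then show "z = y" using F(3)[of z y] z y by simp
    qed
  qed (rule F(1))
  then show ?thesis by blast
qed

text \<open>The same choice as inside \<open>dens\<close>.\<close>

definition fd :: "('g \<times> 'h) set" where "fd = (SOME F. fundamental_domain \<theta>G \<theta>H \<L> F)"

lemma fd: "fundamental_domain \<theta>G \<theta>H \<L> fd"
  unfolding fd_def by (rule someI_ex[OF ex_fundamental_domain])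

lemma fd_in_sets: "fd \<in> sets haar_product"
  and fd_compact: "compact (closure fd)"
  and fd_ex1: "\<exists>!y. y \<in> fd \<and> x - y \<in> \<L>"
  using fd unfolding fundamental_domain_def relatively_compact_def by blast+

lemma fd_inj: "x \<in> fd \<Longrightarrow> y \<in> fd \<Longrightarrow> x - y \<in> \<L> \<Longrightarrow> x = y"
  using fd_ex1[of x] lattice_zero by (metis diff_self)

definition fd_G :: "'g set" where "fd_G = fst ` closure fd"
definition fd_H :: "'h set" where "fd_H = snd ` closure fd"

lemma compact_fd_G: "compact fd_G" and compact_fd_H: "compact fd_H"
  unfolding fd_G_def fd_H_def by (intro compact_continuous_image continuous_intros fd_compact)+

lemma fst_fd: "x \<in> fd \<Longrightarrow> fst x \<in> fd_G" and snd_fd: "x \<in> fd \<Longrightarrow> snd x \<in> fd_H"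
  using closure_subset[of fd] by (auto simp: fd_G_def fd_H_def)

text \<open>Finite because the projections \<open>fd_G\<close> and \<open>fd_H\<close> are compact;
  positive because countably many translates of \<open>fd\<close> cover the whole product, which is
  not null. Positivity keeps \<open>dens\<close> away from division by 0.\<close>

lemma fd_emeasure: "emeasure haar_product fd = ennreal (measure haar_product fd)"
  and fd_measure_pos: "measure haar_product fd > 0"
proof -
  have "emeasure haar_product fd \<le> emeasure haar_product (fd_G \<times> fd_H)"
    using fst_fd snd_fd
    by (intro emeasure_mono Times_in_sets borel_compact compact_fd_G compact_fd_H) (auto simp: mem_Times_iff)
  also have "\<dots> = emeasure \<theta>G fd_G * emeasure \<theta>H fd_H"
    by (intro emeasure_Times borel_compact compact_fd_G compact_fd_H)
  also have "\<dots> < \<infinity>"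
    using haar_measure_compact[OF haar_G compact_fd_G] haar_measure_compact[OF haar_H compact_fd_H]
    by (simp add: ennreal_mult_less_top)
  finally have fin: "emeasure haar_product fd < \<infinity>" .
  then show eq: "emeasure haar_product fd = ennreal (measure haar_product fd)"
    by (intro emeasure_eq_ennreal_measure) auto
  have "emeasure haar_product fd \<noteq> 0"
  proof
    assume 0: "emeasure haar_product fd = 0"
    have "emeasure haar_product (\<Union>l\<in>\<L>. l +o fd) = 0"
      using countable_lattice 0 product_translate[OF fd_in_sets]
      by (intro null_setsD1 null_sets_UN') auto
    moreover have "(\<Union>l\<in>\<L>. l +o fd) = UNIV"
    proof -
      have "x \<in> (\<Union>l\<in>\<L>. l +o fd)" for x
      proof -
        obtain y where "y \<in> fd" "x - y \<in> \<L>" using fd_ex1 by blast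
        then show ?thesis using set_plus_intro2[of y fd "x - y"] by auto
      qed
      then show ?thesis by auto
    qed
    moreover obtain K1 where K1: "compact K1" "emeasure \<theta>G K1 \<noteq> 0"
      using haar_measure_pos_compact[OF sigma_compact_G haar_G] by blast
    obtain K2 where K2: "compact K2" "emeasure \<theta>H K2 \<noteq> 0"
      using haar_measure_pos_compact[OF sigma_compact_H haar_H] by blast
    have "emeasure haar_product (K1 \<times> K2) \<noteq> 0"
      using K1 K2 by (simp add: emeasure_Times borel_compact)
    moreover have "emeasure haar_product (K1 \<times> K2) \<le> emeasure haar_product UNIV"
      using haar_measure_space[OF haar_G] haar_measure_space[OF haar_H] sets.top[of haar_product]
      by (intro emeasure_mono) (auto simp: space_pair_measure)
    ultimately show False by simp
  qed
  then show "measure haar_product fd > 0" unfolding eq by (simp add: zero_less_iff_neq_zero ennreal_eq_0_iff not_le)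
qed

lemma dens_eq: "dens \<theta>G \<theta>H \<L> = 1 / measure haar_product fd"
  by (simp add: dens_def fd_def)

lemma dens_pos: "dens \<theta>G \<theta>H \<L> > 0"
  using fd_measure_pos by (simp add: dens_eq)

text \<open>The sets \<open>l + e + Q e\<close> are disjoint: a common point makes two elements of
  \<open>fd\<close> congruent, hence equal, which forces the same piece and then the same
  \<open>l\<close>. For each \<open>l\<close> their measures add up to that of \<open>fd\<close>.
  With the single piece \<open>fd\<close> the lemma also bounds boundary effects.\<close>

lemma packing:
  assumes S: "finite S" "S \<subseteq> \<L>" and E: "finite E" "E \<subseteq> \<L>"
    and Q: "\<And>e. e \<in> E \<Longrightarrow> Q e \<in> sets haar_product" "disjoint_family_on Q E" "\<Union> (Q ` E) = fd"
    and R: "R \<in> sets borel" "emeasure \<theta>G R < \<infinity>" and P: "P \<in> sets borel" "emeasure \<theta>H P < \<infinity>"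
    and sub: "\<And>l e x. l \<in> S \<Longrightarrow> e \<in> E \<Longrightarrow> x \<in> Q e \<Longrightarrow> l + e + x \<in> R \<times> P"
  shows "real (card S) \<le> dens \<theta>G \<theta>H \<L> * measure \<theta>G R * measure \<theta>H P"
proof -
  let ?T = "\<lambda>p. (fst p + snd p) +o Q (snd p)"
  have disj: "disjoint_family_on ?T (S \<times> E)"
    unfolding disjoint_family_on_def
  proof (intro ballI impI)
    fix p p' assume p: "p \<in> S \<times> E" "p' \<in> S \<times> E" "p \<noteq> p'"
    show "?T p \<inter> ?T p' = {}"
    proof (rule ccontr)
      assume "?T p \<inter> ?T p' \<noteq> {}"
      then obtain x x' where x: "x \<in> Q (snd p)" "x' \<in> Q (snd p')"
        "fst p + snd p + x = fst p' + snd p' + x'"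
        by (fastforce simp: elt_set_plus_def)
      have "x \<in> fd" "x' \<in> fd" using x p Q(3) by (auto simp: mem_Times_iff)
      moreover have "x - x' = (fst p' + snd p') - (fst p + snd p)"
        using x(3) by (simp add: algebra_simps)
      then have "x - x' \<in> \<L>" using p S E by (auto intro!: lattice_diff lattice_add)
      ultimately have "x = x'" by (rule fd_inj)
      then have "snd p = snd p'" using x p Q(2) by (fastforce simp: disjoint_family_on_def)
      moreover from this have "fst p = fst p'" using x(3) \<open>x = x'\<close> by simp
      ultimately show False using p(3) by (simp add: prod_eq_iff)
    qed
  qed
  have Ts: "?T p \<in> sets haar_product" if "p \<in> S \<times> E" for p
    using that Q(1) by (intro product_translate) auto
  have "of_nat (card S) * emeasure haar_product fd = (\<Sum>l\<in>S. \<Sum>e\<in>E. emeasure haar_product (Q e))"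
    using sum_emeasure[of Q E haar_product] Q E by (simp add: image_subsetI)
  also have "\<dots> = (\<Sum>p\<in>S \<times> E. emeasure haar_product (Q (snd p)))"
    by (subst sum.cartesian_product) (auto intro!: sum.cong)
  also have "\<dots> = (\<Sum>p\<in>S \<times> E. emeasure haar_product (?T p))"
    using Q(1) by (intro sum.cong refl product_translate(2)[symmetric]) auto
  also have "\<dots> = emeasure haar_product (\<Union> (?T ` (S \<times> E)))"
    using Ts disj S E by (intro sum_emeasure) auto
  also have "\<dots> \<le> emeasure haar_product (R \<times> P)"
    using sub R P by (intro emeasure_mono Times_in_sets) (force simp: elt_set_plus_def)+
  also have "\<dots> = emeasure \<theta>G R * emeasure \<theta>H P" using R P by (intro emeasure_Times)
  also have "\<dots> = ennreal (measure \<theta>G R * measure \<theta>H P)"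
    using R P by (simp add: emeasure_eq_ennreal_measure ennreal_mult)
  finally have "real (card S) * measure haar_product fd \<le> measure \<theta>G R * measure \<theta>H P"
    unfolding fd_emeasure by (simp add: ennreal_of_nat_eq_real_of_nat flip: ennreal_mult)
  then show ?thesis using fd_measure_pos by (simp add: dens_eq field_simps)
qed

section \<open>Counting lattice points in translated boxes\<close>

text \<open>
  \<open>hits (t, - h) A V\<close> corresponds bijectively to \<open>t\<Lambda>(hV) \<inter> A\<close>.
\<close>

definition hits :: "'g \<times> 'h \<Rightarrow> 'g set \<Rightarrow> 'h set \<Rightarrow> ('g \<times> 'h) set" where
  "hits \<eta> R P = {l \<in> \<L>. l + \<eta> \<in> R \<times> P}"

lemma mem_hits: "l \<in> hits \<eta> R P \<longleftrightarrow> l \<in> \<L> \<and> fst l + fst \<eta> \<in> R \<and> snd l + snd \<eta> \<in> P"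
  by (simp add: hits_def mem_Times_iff)

lemma hits_empty [simp]: "hits \<eta> R {} = {}"
  by (simp add: hits_def)

lemma finite_hits: "compact R \<Longrightarrow> compact P \<Longrightarrow> finite (hits \<eta> R P)"
  unfolding hits_def by (rule finite_lattice_box)

lemma star_map_fst: "l \<in> \<L> \<Longrightarrow> star_map \<L> (fst l) = snd l"
  by (simp add: star_map_def inv_into_f_f[OF inj_on_fst])

lemma mem_model_set: "x \<in> model_set \<L> V \<longleftrightarrow> (\<exists>l\<in>\<L>. x = fst l \<and> snd l \<in> V)"
proof
  assume "x \<in> model_set \<L> V"
  then obtain l where "l \<in> \<L>" "x = fst l" "star_map \<L> x \<in> V" by (auto simp: model_set_def)
  then show "\<exists>l\<in>\<L>. x = fst l \<and> snd l \<in> V" by (intro bexI[of _ l]) (simp_all add: star_map_fst)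
next
  assume "\<exists>l\<in>\<L>. x = fst l \<and> snd l \<in> V"
  then obtain l where "l \<in> \<L>" "x = fst l" "snd l \<in> V" by auto
  then show "x \<in> model_set \<L> V" by (simp add: model_set_def star_map_fst)
qed

text \<open>Points of the translated model set correspond to lattice vectors because
  \<open>fst\<close> is injective on the lattice; translating the window by \<open>h\<close> means
  subtracting \<open>h\<close> from the star image.\<close>

lemma relative_frequency_eq:
  "relative_frequency \<theta>G \<L> A n V \<xi> = real (card (hits (fst \<xi>, - snd \<xi>) (A n) V)) / measure \<theta>G (A n)"
proof -
  let ?S = "hits (fst \<xi>, - snd \<xi>) (A n) V"
  have "(fst \<xi> +o model_set \<L> (snd \<xi> +o V)) \<inter> A n = (\<lambda>l. fst l + fst \<xi>) ` ?S"
  proof (intro subset_antisym subsetI)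
    fix x assume "x \<in> (fst \<xi> +o model_set \<L> (snd \<xi> +o V)) \<inter> A n"
    then have "x - fst \<xi> \<in> model_set \<L> (snd \<xi> +o V)" "x \<in> A n" by (simp_all add: set_minus_plus)
    then obtain l where l: "l \<in> \<L>" "x - fst \<xi> = fst l" "snd l - snd \<xi> \<in> V" "x \<in> A n"
      unfolding mem_model_set set_minus_plus by auto
    then have "l \<in> ?S" "x = fst l + fst \<xi>" by (auto simp: mem_hits algebra_simps)
    then show "x \<in> (\<lambda>l. fst l + fst \<xi>) ` ?S" by simp
  next
    fix x assume "x \<in> (\<lambda>l. fst l + fst \<xi>) ` ?S"
    then obtain l where "l \<in> ?S" "x = fst l + fst \<xi>" by auto
    then have l: "l \<in> \<L>" "snd l - snd \<xi> \<in> V" "x \<in> A n" "x - fst \<xi> = fst l" by (auto simp: mem_hits)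
    then have "x - fst \<xi> \<in> model_set \<L> (snd \<xi> +o V)" unfolding mem_model_set set_minus_plus[symmetric] by auto
    from this[unfolded set_minus_plus] l(3) show "x \<in> (fst \<xi> +o model_set \<L> (snd \<xi> +o V)) \<inter> A n"
      by (rule IntI)
  qed
  moreover have "inj_on (\<lambda>l. fst l + fst \<xi>) ?S"
    using inj_on_fst by (auto simp: inj_on_def mem_hits)
  ultimately show ?thesis by (simp add: relative_frequency_def card_image)
qed

text \<open>Replacing \<open>l\<close> by \<open>l - m\<close> trades the translation in
  \<open>G\<close> for one in \<open>H\<close>: the pattern at \<open>fst m\<close> depends on
  \<open>m\<close> only through its star image \<open>snd m\<close>.\<close>

lemma translated_model_set:
  assumes "m \<in> \<L>"
  shows "((- fst m) +o model_set \<L> V) \<inter> R = fst ` hits (0, snd m) R V"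
proof (intro subset_antisym subsetI)
  fix x assume "x \<in> ((- fst m) +o model_set \<L> V) \<inter> R"
  then have "x + fst m \<in> model_set \<L> V" "x \<in> R" by (simp_all add: set_minus_plus[symmetric])
  then obtain l where l: "l \<in> \<L>" "x + fst m = fst l" "snd l \<in> V" "x \<in> R"
    unfolding mem_model_set by auto
  then have "x = fst (l - m)" by (simp add: algebra_simps)
  moreover have "l - m \<in> hits (0, snd m) R V"
    using l lattice_diff[OF l(1) assms] \<open>x = fst (l - m)\<close> by (simp add: mem_hits)
  ultimately show "x \<in> fst ` hits (0, snd m) R V" by (rule image_eqI)
next
  fix x assume "x \<in> fst ` hits (0, snd m) R V"
  then obtain l where l: "l \<in> \<L>" "x = fst l" "x \<in> R" "snd l + snd m \<in> V" by (auto simp: mem_hits)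
  then have "x + fst m \<in> model_set \<L> V" unfolding mem_model_set using lattice_add[OF l(1) assms]
    by (intro bexI[of _ "l + m"]) auto
  then show "x \<in> ((- fst m) +o model_set \<L> V) \<inter> R" using l by (simp add: set_minus_plus[symmetric])
qed

section \<open>Density of the star image and upper bounds for counts\<close>

lemma dense_lattice_projection:
  assumes "open V" "0 \<in> V"
  obtains e where "e \<in> \<L>" "y + snd e \<in> V"
proof -
  have "open ((\<lambda>u. y + u) -` V)" by (intro open_vimage assms continuous_intros)
  moreover have "- y \<in> (\<lambda>u. y + u) -` V" using assms by simp
  moreover have "- y \<in> closure (snd ` \<L>)" unfolding dense_snd by simp
  ultimately have "(\<lambda>u. y + u) -` V \<inter> snd ` \<L> \<noteq> {}"
    unfolding closure_iff_nhds_not_empty by blast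
  then show thesis using that by auto
qed

text \<open>Compactness makes the density of the star image uniform over \<open>B\<close>. The shift
  \<open>c\<close> sets the target: \<open>- snd \<eta>\<close> in the density bound, the offset of
  the reference parameters in the pattern count.\<close>

lemma finite_lattice_cover:
  assumes "open V" "0 \<in> V" "compact B"
  obtains E where "finite E" "E \<subseteq> \<L>" "\<And>y. y \<in> B \<Longrightarrow> \<exists>e\<in>E. y + snd e + c \<in> V"
proof -
  have "open ((\<lambda>y. y + snd e + c) -` V)" for e :: "'g \<times> 'h"
    by (intro open_vimage assms continuous_intros)
  moreover have "B \<subseteq> (\<Union>e\<in>\<L>. (\<lambda>y. y + snd e + c) -` V)"
  proof
    fix y
    obtain e where "e \<in> \<L>" "(y + c) + snd e \<in> V" using dense_lattice_projection[OF assms(1,2)] .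
    then have "y + snd e + c \<in> V" by (simp add: algebra_simps)
    then show "y \<in> (\<Union>e\<in>\<L>. (\<lambda>y. y + snd e + c) -` V)" using \<open>e \<in> \<L>\<close> by auto
  qed
  ultimately obtain E where E: "E \<subseteq> \<L>" "finite E" "B \<subseteq> (\<Union>e\<in>E. (\<lambda>y. y + snd e + c) -` V)"
    by (rule compactE_image[OF assms(3)])
  show thesis by (rule that[OF E(2,1)]) (use E(3) in auto)
qed

text \<open>Moving the piece \<open>Q e\<close> by \<open>e\<close> brings its
  \<open>H\<close>-component within \<open>V\<close> of \<open>snd \<eta>\<close>, so the sets
  attached to the hits lie over \<open>K + V \<subseteq> T\<close>. The price is a displacement in
  \<open>G\<close>, bounded by a compact \<open>C\<close> that does not depend on
  \<open>R\<close>.\<close>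

lemma card_hits_le_density:
  assumes K: "compact K" and T: "open T" "K \<subseteq> T" "T \<in> fmeasurable \<theta>H"
  obtains C where "compact C"
    "\<And>R. compact R \<Longrightarrow> real (card (hits \<eta> R K)) \<le> dens \<theta>G \<theta>H \<L> * measure \<theta>G (R + C) * measure \<theta>H T"
proof -
  obtain V where V: "open V" "0 \<in> V" "K + V \<subseteq> T"
    using compact_plus_nbhd_subset_open[OF K T(1,2)] .
  obtain E where E: "finite E" "E \<subseteq> \<L>" "\<And>y. y \<in> fd_H \<Longrightarrow> \<exists>e\<in>E. y + snd e + (- snd \<eta>) \<in> V"
    using finite_lattice_cover[OF V(1,2) compact_fd_H, of "- snd \<eta>"] by blast
  define D where "D e = fd \<inter> UNIV \<times> ((\<lambda>y. y + snd e + (- snd \<eta>)) -` V)" for e :: "'g \<times> 'h"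
  have Dm: "D e \<in> sets haar_product" for e
    unfolding D_def
    by (intro sets.Int fd_in_sets Times_in_sets borel_open open_vimage V continuous_intros) auto
  have DU: "\<Union> (D ` E) = fd"
  proof (intro subset_antisym subsetI)
    fix x assume x: "x \<in> fd"
    obtain e where "e \<in> E" "snd x + snd e + (- snd \<eta>) \<in> V" using E(3)[OF snd_fd[OF x]] ..
    then show "x \<in> \<Union> (D ` E)" using x by (intro UN_I[of e]) (auto simp: D_def mem_Times_iff)
  qed (auto simp: D_def)
  have "\<exists>Q. (\<forall>e\<in>E. Q e \<in> sets haar_product \<and> Q e \<subseteq> D e) \<and> disjoint_family_on Q E \<and> \<Union> (Q ` E) = \<Union> (D ` E)"
    by (rule disjoint_refinement_finite[OF E(1) Dm])
  then obtain Q where Q0: "\<forall>e\<in>E. Q e \<in> sets haar_product \<and> Q e \<subseteq> D e"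
    and Q: "disjoint_family_on Q E" "\<Union> (Q ` E) = \<Union> (D ` E)"
    by (elim exE conjE)
  have Qm: "Q e \<in> sets haar_product" and QD: "Q e \<subseteq> D e" if "e \<in> E" for e
    using bspec[OF Q0 that] by simp_all
  \<comment> \<open>Relative to \<open>l + \<eta>\<close>, the set attached to \<open>l\<close> is
    displaced in \<open>G\<close> by \<open>fst e - fst \<eta>\<close> plus elements of
    \<open>fd_G\<close>.\<close>
  define C where "C = (\<Union>e\<in>E. (fst e - fst \<eta>) +o fd_G)"
  have C: "compact C" unfolding C_def by (intro compact_UN E ballI compact_elt_set_plus compact_fd_G)
  show thesis
  proof (rule that[OF C])
    fix R :: "'g set" assume R: "compact R"
    have RC: "compact (R + C)" by (intro compact_set_plus R C)
    show "real (card (hits \<eta> R K)) \<le> dens \<theta>G \<theta>H \<L> * measure \<theta>G (R + C) * measure \<theta>H T"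
    proof (rule packing[OF finite_hits[OF R K] _ E(1,2) Qm Q(1) Q(2)[unfolded DU]])
      show "hits \<eta> R K \<subseteq> \<L>" by (auto simp: mem_hits)
      show "R + C \<in> sets borel" using RC by (rule borel_compact)
      show "emeasure \<theta>G (R + C) < \<infinity>" using haar_measure_compact[OF haar_G RC] .
      show "T \<in> sets borel" using T(1) by (rule borel_open)
      show "emeasure \<theta>H T < \<infinity>" using T(3) by (simp add: fmeasurable_def)
      fix l e x assume l: "l \<in> hits \<eta> R K" and e: "e \<in> E" and x: "x \<in> Q e"
      have "x \<in> D e" using QD[OF e] x by (rule subsetD)
      then have xf: "x \<in> fd" and xv: "snd x + snd e + (- snd \<eta>) \<in> V" by (auto simp: D_def)
      have "(fst e - fst \<eta>) + fst x \<in> (fst e - fst \<eta>) +o fd_G" using fst_fd[OF xf] by (rule set_plus_intro2)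
      then have "(fst e - fst \<eta>) + fst x \<in> C" unfolding C_def using e by (rule UN_I[rotated])
      then have "(fst l + fst \<eta>) + ((fst e - fst \<eta>) + fst x) \<in> R + C"
        using l by (intro set_plus_intro) (simp_all add: mem_hits)
      moreover have "(snd l + snd \<eta>) + (snd x + snd e + (- snd \<eta>)) \<in> K + V"
        using l xv by (intro set_plus_intro) (simp_all add: mem_hits)
      then have "(snd l + snd \<eta>) + (snd x + snd e + (- snd \<eta>)) \<in> T" using V(3) by (rule subsetD[rotated])
      ultimately show "l + e + x \<in> (R + C) \<times> T" by (simp add: mem_Times_iff algebra_simps)
    qed simp_all
  qed
qed

text \<open>A hit gained by the translation has its \<open>G\<close>-component outside
  \<open>R\<close> before and inside \<open>R\<close> after adding \<open>s\<close>, so the domain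
  attached to it lies over a van Hove boundary of \<open>R\<close>; packing bounds the number of
  such hits by the measure of that boundary.\<close>

lemma card_hits_translate_le:
  assumes P: "compact P"
  obtains K c where "compact K"
    "\<And>R. compact R \<Longrightarrow>
      real (card (hits (\<eta> + (s, 0)) R P)) \<le> real (card (hits \<eta> R P)) + c * measure \<theta>G (van_Hove_boundary K R)"
proof -
  \<comment> \<open>\<open>K1\<close> holds the displacements from \<open>fst l + fst \<eta>\<close>
    to the attached domain, and \<open>(- s) +o K1\<close> those from the translated point.\<close>
  define K1 where "K1 = (- fst \<eta>) +o fd_G"
  define K where "K = K1 \<union> ((- s) +o K1)"
  define P' where "P' = P + ((- snd \<eta>) +o fd_H)"
  have K1: "compact K1" unfolding K1_def by (intro compact_elt_set_plus compact_fd_G)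
  then have K: "compact K" unfolding K_def by (intro compact_Un compact_elt_set_plus)
  have P': "compact P'" unfolding P'_def by (intro compact_set_plus P compact_elt_set_plus compact_fd_H)
  show thesis
  proof (rule that[OF K])
    fix R :: "'g set" assume R: "compact R"
    have cR: "closure R = R" using R by (simp add: compact_imp_closed closure_closed)
    have bR: "compact (van_Hove_boundary K R)" using K R cR by (intro compact_van_Hove_boundary) auto
    let ?S = "hits (\<eta> + (s, 0)) R P - hits \<eta> R P"
    have fin: "finite (hits \<eta> R P)" "finite (hits (\<eta> + (s, 0)) R P)" using R P by (rule finite_hits)+
    have "real (card ?S) \<le> dens \<theta>G \<theta>H \<L> * measure \<theta>G (van_Hove_boundary K R) * measure \<theta>H P'"
    proof (rule packing[where E = "{0}" and Q = "\<lambda>_. fd"])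
      show "finite ?S" using fin by simp
      show "?S \<subseteq> \<L>" "{0} \<subseteq> \<L>" using lattice_zero by (auto simp: mem_hits)
      show "van_Hove_boundary K R \<in> sets borel" "P' \<in> sets borel"
        using bR P' by (auto intro: borel_compact)
      show "emeasure \<theta>G (van_Hove_boundary K R) < \<infinity>" "emeasure \<theta>H P' < \<infinity>"
        using haar_measure_compact[OF haar_G bR] haar_measure_compact[OF haar_H P'] .
      fix l e x assume l: "l \<in> ?S" and e: "e \<in> {0 :: 'g \<times> 'h}" and x: "x \<in> fd"
      have lP: "snd l + snd \<eta> \<in> P" and lR: "fst l + fst \<eta> + s \<in> R" and lR': "fst l + fst \<eta> \<notin> R"
        using l by (auto simp: mem_hits add.assoc)
      have "(snd l + snd \<eta>) + (- snd \<eta> + snd x) \<in> P'"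
        unfolding P'_def using lP snd_fd[OF x] by (intro set_plus_intro set_plus_intro2)
      then have 2: "snd l + snd x \<in> P'" by simp
      define c where "c = - fst \<eta> + fst x"
      have c: "c \<in> K1" unfolding c_def K1_def using fst_fd[OF x] by (rule set_plus_intro2)
      have "fst l + fst x \<in> van_Hove_boundary K R"
      \<comment> \<open>The cases are the two halves of the boundary: inside \<open>R\<close> but
        within \<open>K\<close> of the old point outside, or outside \<open>R\<close> but within
        \<open>K\<close> of the new point inside.\<close>
      proof (cases "fst l + fst x \<in> R")
        case True
        have "c + (fst l + fst \<eta>) \<in> K + closure (- R)"
          using c lR' closure_subset[of "- R"] by (intro set_plus_intro) (auto simp: K_def)
        then show ?thesis using True cR by (simp add: c_def van_Hove_boundary_def algebra_simps)
      next
        case False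
        then have "fst l + fst x \<in> closure (- R)" using closure_subset[of "- R"] by auto
        moreover have "(- s + c) + (fst l + fst \<eta> + s) \<in> K + closure R"
          using set_plus_intro2[OF c, of "- s"] lR by (intro set_plus_intro) (auto simp: K_def cR)
        ultimately show ?thesis by (simp add: c_def van_Hove_boundary_def algebra_simps)
      qed
      then show "l + e + x \<in> van_Hove_boundary K R \<times> P'" using 2 e by (simp add: mem_Times_iff)
    qed (auto simp: fd_in_sets disjoint_family_on_def)
    moreover have "card (hits (\<eta> + (s, 0)) R P) \<le> card (hits \<eta> R P) + card ?S"
    proof -
      have "card (hits (\<eta> + (s, 0)) R P) \<le> card (hits \<eta> R P \<union> ?S)"
        using fin by (intro card_mono) auto
      also have "\<dots> \<le> card (hits \<eta> R P) + card ?S" by (rule card_Un_le)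
      finally show ?thesis .
    qed
    ultimately show "real (card (hits (\<eta> + (s, 0)) R P)) \<le> real (card (hits \<eta> R P))
        + (dens \<theta>G \<theta>H \<L> * measure \<theta>H P') * measure \<theta>G (van_Hove_boundary K R)"
      by (simp add: algebra_simps)
  qed
qed

lemma card_hits_lattice_translate:
  assumes "e \<in> \<L>"
  shows "card (hits (\<eta> + e) R P) = card (hits \<eta> R P)"
proof -
  have "bij_betw (\<lambda>l. l + e) (hits (\<eta> + e) R P) (hits \<eta> R P)"
  proof (rule bij_betwI[where g = "\<lambda>l. l - e"])
    show "(\<lambda>l. l + e) \<in> hits (\<eta> + e) R P \<rightarrow> hits \<eta> R P"
      using lattice_add[OF _ assms] by (auto simp: hits_def add.commute add.left_commute)
    show "(\<lambda>l. l - e) \<in> hits \<eta> R P \<rightarrow> hits (\<eta> + e) R P"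
      using lattice_diff[OF _ assms] by (auto simp: hits_def)
  qed auto
  then show ?thesis by (rule bij_betw_same_card)
qed

text \<open>If a move by \<open>b - a\<close> changes the membership of \<open>z\<close> in
  \<open>W\<close>, then \<open>z\<close> and the moved point lie on different sides and differ by
  an element of \<open>U\<close>, which places \<open>z\<close> in the van Hove boundary.\<close>

lemma hits_eq_off_van_Hove_boundary:
  assumes "b - a \<in> U" "a - b \<in> U"
  shows "hits (0, b) R W - hits (0, a) R (van_Hove_boundary U W)
       = hits (0, a) R W - hits (0, a) R (van_Hove_boundary U W)"
proof -
  have moved: "z \<in> van_Hove_boundary U W" if "(z + (b - a) \<in> W) \<noteq> (z \<in> W)" for z
  proof -
    have *: "z = (a - b) + (z + (b - a))" by simp
    show ?thesis
    proof (cases "z \<in> W")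
      case True
      then have "(a - b) + (z + (b - a)) \<in> U + closure (- W)"
        using that assms closure_subset[of "- W"] by (intro set_plus_intro) auto
      then show ?thesis using True closure_subset[of W] *[symmetric] by (auto simp: van_Hove_boundary_def)
    next
      case False
      then have "(a - b) + (z + (b - a)) \<in> U + closure W"
        using that assms closure_subset[of W] by (intro set_plus_intro) auto
      then show ?thesis using False closure_subset[of "- W"] *[symmetric] by (auto simp: van_Hove_boundary_def)
    qed
  qed
  have "h + b \<in> W \<longleftrightarrow> h + a \<in> W" if "h + a \<notin> van_Hove_boundary U W" for h
    using that moved[of "h + a"] by auto
  then show ?thesis by (auto simp: mem_hits)
qed

section \<open>Counting patterns\<close>

text \<open>
  Pairs of windows serve the coloured patterns; the uncoloured case is \<open>W' = {}\<close>, whose boundary is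
  empty.
\<close>

definition window_patterns :: "'g set \<Rightarrow> 'h set \<Rightarrow> 'h set \<Rightarrow> 'h set \<Rightarrow> (('g \<times> 'h) set \<times> ('g \<times> 'h) set) set" where
  "window_patterns R W W' B = (\<lambda>b. (hits (0, b) R W, hits (0, b) R W')) ` B"

text \<open>Each \<open>b\<close> is within \<open>U\<close> of a reference parameter
  \<open>snd e + h\<close> with \<open>e \<in> E\<close>, so its pair of patterns agrees with the
  reference pair off the hits of the boundaries; per \<open>e\<close> only the traces on these
  finite sets are free. The arbitrary offset \<open>h\<close> lets frequencies be taken at any base
  point.\<close>

lemma window_patterns_bound:
  assumes W: "compact (closure W)" "compact (closure W')" and B: "B \<subseteq> B'" "compact B'"
    and U: "compact U" "0 \<in> interior U"
  shows "\<exists>E. finite E \<and> E \<subseteq> \<L> \<and> (\<forall>R. compact R \<longrightarrow> finite (window_patterns R W W' B) \<and>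
    card (window_patterns R W W' B) \<le>
      (\<Sum>e\<in>E. 2 ^ (card (hits (0, snd e + h) R (van_Hove_boundary U W))
                 + card (hits (0, snd e + h) R (van_Hove_boundary U W')))))"
proof -
  \<comment> \<open>Symmetric, since differences of either sign must lie in
    \<open>U\<close>.\<close>
  define V where "V = interior U \<inter> uminus -` interior U"
  have V: "open V" "0 \<in> V"
    unfolding V_def using U(2) by (auto intro!: open_Int open_vimage continuous_intros)
  \<comment> \<open>The cover is applied to \<open>y = - b\<close>, so that
    \<open>y + snd e + h\<close> is the difference between reference parameter and
    \<open>b\<close>.\<close>
  have cB: "compact (uminus ` B')" by (intro compact_continuous_image continuous_intros B)
  obtain E where E: "finite E" "E \<subseteq> \<L>" "\<And>y. y \<in> uminus ` B' \<Longrightarrow> \<exists>e\<in>E. y + snd e + h \<in> V"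
    using finite_lattice_cover[OF V cB, of h] by blast
  define Z where "Z R X e = hits (0, snd e + h) R (van_Hove_boundary U X)" for R X and e :: "'g \<times> 'h"
  define C where "C R X e = {Y. Y - Z R X e = hits (0, snd e + h) R X - Z R X e}" for R X e
  have fZ: "finite (Z R X e)" if "compact R" "compact (closure X)" for R X e
    unfolding Z_def using that U(1) by (intro finite_hits compact_van_Hove_boundary)
  have sub: "window_patterns R W W' B \<subseteq> (\<Union>e\<in>E. C R W e \<times> C R W' e)" for R
    unfolding window_patterns_def
  proof (rule image_subsetI)
    fix b assume "b \<in> B"
    then have "- b \<in> uminus ` B'" using B(1) by auto
    then obtain e where e: "e \<in> E" "- b + snd e + h \<in> V" using E(3) by blast
    then have "- b + snd e + h \<in> interior U" "- (- b + snd e + h) \<in> interior U" by (auto simp: V_def)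
    then have "b - (snd e + h) \<in> U" "(snd e + h) - b \<in> U"
      using interior_subset[of U] by (auto simp: algebra_simps)
    then have "(hits (0, b) R W, hits (0, b) R W') \<in> C R W e \<times> C R W' e"
      unfolding C_def Z_def mem_Times_iff fst_conv snd_conv mem_Collect_eq
      by (intro conjI hits_eq_off_van_Hove_boundary)
    with e(1) show "(hits (0, b) R W, hits (0, b) R W') \<in> (\<Union>e\<in>E. C R W e \<times> C R W' e)" by (rule UN_I)
  qed
  show ?thesis
  proof (intro exI[of _ E] conjI allI impI E(1,2))
    fix R :: "'g set" assume R: "compact R"
    note fin = sets_agreeing_off_finite[OF fZ[OF R W(1)]] sets_agreeing_off_finite[OF fZ[OF R W(2)]]
    have finC: "finite (C R W e \<times> C R W' e)" for e unfolding C_def by (intro finite_cartesian_product fin)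
    have finU: "finite (\<Union>e\<in>E. C R W e \<times> C R W' e)" using E(1) finC by (intro finite_UN_I)
    show "finite (window_patterns R W W' B)" using sub finU by (rule finite_subset)
    have "card (window_patterns R W W' B) \<le> card (\<Union>e\<in>E. C R W e \<times> C R W' e)"
      using finU sub by (rule card_mono)
    also have "\<dots> \<le> (\<Sum>e\<in>E. card (C R W e \<times> C R W' e))" using E(1) by (rule card_UN_le)
    also have "\<dots> \<le> (\<Sum>e\<in>E. 2 ^ card (Z R W e) * 2 ^ card (Z R W' e))"
      unfolding C_def by (intro sum_mono) (simp only: card_cartesian_product, intro mult_mono fin le0)
    finally show "card (window_patterns R W W' B) \<le>
      (\<Sum>e\<in>E. 2 ^ (card (hits (0, snd e + h) R (van_Hove_boundary U W))
                 + card (hits (0, snd e + h) R (van_Hove_boundary U W'))))"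
      by (simp add: Z_def power_add)
  qed
qed

text \<open>The pattern at \<open>fst m\<close> is the projection to \<open>G\<close> of the first
  component for \<open>b = snd m\<close>. Finiteness is assumed because \<open>card\<close> of an
  infinite set is 0.\<close>

lemma pattern_number_le_window_patterns:
  assumes "finite (window_patterns R W {} W)"
  shows "pattern_number R (model_set \<L> W) \<le> card (window_patterns R W {} W)"
proof -
  have "{((- x) +o model_set \<L> W) \<inter> R |x. x \<in> model_set \<L> W} \<subseteq> (\<lambda>p. fst ` fst p) ` window_patterns R W {} W"
  proof
    fix Y assume "Y \<in> {((- x) +o model_set \<L> W) \<inter> R |x. x \<in> model_set \<L> W}"
    then obtain x where x: "x \<in> model_set \<L> W" "Y = ((- x) +o model_set \<L> W) \<inter> R" by blast
    obtain m where m: "m \<in> \<L>" "x = fst m" "snd m \<in> W" using x(1) unfolding mem_model_set by blast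
    have "(hits (0, snd m) R W, hits (0, snd m) R {}) \<in> window_patterns R W {} W"
      unfolding window_patterns_def using m(3) by (rule imageI)
    moreover have "Y = fst ` fst (hits (0, snd m) R W, hits (0, snd m) R {} :: ('g \<times> 'h) set)"
      using x(2) translated_model_set[OF m(1)] m(2) by simp
    ultimately show "Y \<in> (\<lambda>p. fst ` fst p) ` window_patterns R W {} W" by (rule rev_image_eqI)
  qed
  then show ?thesis unfolding pattern_number_def using assms
    by (meson card_image_le card_mono finite_imageI order_trans)
qed

text \<open>The second component gives the domain of the colouring, the first one the points
  coloured 1. Base points come from the second model set, so the parameters range over
  \<open>W'\<close>.\<close>

lemma coloured_pattern_number_le_window_patterns:
  assumes "finite (window_patterns R W W' W')"
  shows "coloured_pattern_number R (model_set \<L> W) (model_set \<L> W') \<le> card (window_patterns R W W' W')"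
proof -
  let ?f = "\<lambda>p. colouring (fst ` fst p) (fst ` snd p)"
  have "{colouring (((- x) +o model_set \<L> W) \<inter> R) (((- x) +o model_set \<L> W') \<inter> R) |x. x \<in> model_set \<L> W'}
      \<subseteq> ?f ` window_patterns R W W' W'" (is "?L \<subseteq> _")
  proof
    fix Y assume "Y \<in> ?L"
    then obtain x where x: "x \<in> model_set \<L> W'"
      "Y = colouring (((- x) +o model_set \<L> W) \<inter> R) (((- x) +o model_set \<L> W') \<inter> R)" by blast
    obtain m where m: "m \<in> \<L>" "x = fst m" "snd m \<in> W'" using x(1) unfolding mem_model_set by blast
    have "(hits (0, snd m) R W, hits (0, snd m) R W') \<in> window_patterns R W W' W'"
      unfolding window_patterns_def using m(3) by (rule imageI)
    moreover have "Y = ?f (hits (0, snd m) R W, hits (0, snd m) R W')"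
      using x(2) translated_model_set[OF m(1)] m(2) by simp
    ultimately show "Y \<in> ?f ` window_patterns R W W' W'" by (rule rev_image_eqI)
  qed
  then show ?thesis unfolding coloured_pattern_number_def using assms
    by (meson card_image_le card_mono finite_imageI order_trans)
qed

end

section \<open>Frequencies and entropy along a van Hove sequence\<close>

locale cut_and_project_van_Hove = cut_and_project \<L> \<theta>G \<theta>H
  for \<L> :: "('g::{topological_ab_group_add, t2_space} \<times> 'h::{topological_ab_group_add, t2_space}) set"
    and \<theta>G \<theta>H +
  fixes A :: "nat \<Rightarrow> 'g set"
  assumes van_Hove: "van_Hove_sequence \<theta>G A"
    and noncompact: "\<not> compact (UNIV :: 'g set)"
begin

lemma compact_A: "compact (A n)" and measure_A_pos: "measure \<theta>G (A n) > 0"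
  using van_Hove by (auto simp: van_Hove_sequence_def)

lemma measure_boundary_tendsto_0:
  "compact K \<Longrightarrow> (\<lambda>n. measure \<theta>G (van_Hove_boundary K (A n)) / measure \<theta>G (A n)) \<longlonglongrightarrow> 0"
  using van_Hove by (auto simp: van_Hove_sequence_def)

text \<open>For \<open>\<eta> = (t, - h)\<close> this is \<open>relative_frequency\<close> at
  \<open>(t, h)\<close>.\<close>

definition freq :: "nat \<Rightarrow> 'h set \<Rightarrow> 'g \<times> 'h \<Rightarrow> real" where
  "freq n P \<eta> = real (card (hits \<eta> (A n) P)) / measure \<theta>G (A n)"

lemma freq_empty [simp]: "freq n {} \<eta> = 0"
  by (simp add: freq_def)

lemma card_hits_eq_freq: "real (card (hits \<eta> (A n) P)) = measure \<theta>G (A n) * freq n P \<eta>"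
  using measure_A_pos[of n] by (simp add: freq_def)

text \<open>Half of \<open>\<epsilon>\<close> pays for replacing \<open>K\<close> by a slightly
  larger open \<open>T\<close>, the other half for enlarging \<open>A n\<close> by \<open>C\<close>,
  which the van Hove property makes negligible.\<close>

lemma freq_eventually_le:
  assumes K: "compact K" and \<epsilon>: "\<epsilon> > 0"
  shows "\<forall>\<^sub>F n in sequentially. freq n K \<eta> \<le> dens \<theta>G \<theta>H \<L> * measure \<theta>H K + \<epsilon>"
proof -
  let ?d = "dens \<theta>G \<theta>H \<L>"
  have "\<epsilon> / 2 / ?d > 0" using \<epsilon> dens_pos by simp
  then obtain T where T: "open T" "K \<subseteq> T" "T \<in> fmeasurable \<theta>H" "measure \<theta>H T < measure \<theta>H K + \<epsilon> / 2 / ?d"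
    by (rule haar_measure_outer_regular_compact[OF haar_H K])
  have dT: "?d * measure \<theta>H T \<le> ?d * measure \<theta>H K + \<epsilon> / 2"
    using mult_left_mono[OF less_imp_le[OF T(4)] less_imp_le[OF dens_pos]] dens_pos by (simp add: distrib_left)
  obtain C where C: "compact C"
    "\<And>R. compact R \<Longrightarrow> real (card (hits \<eta> R K)) \<le> ?d * measure \<theta>G (R + C) * measure \<theta>H T"
    using card_hits_le_density[OF K T(1-3)] by blast
  let ?r = "\<lambda>n. measure \<theta>G (van_Hove_boundary C (A n)) / measure \<theta>G (A n)"
  have "(\<lambda>n. ?d * measure \<theta>H T * ?r n) \<longlonglongrightarrow> ?d * measure \<theta>H T * 0"
    by (intro tendsto_intros measure_boundary_tendsto_0 C)
  then have "\<forall>\<^sub>F n in sequentially. ?d * measure \<theta>H T * ?r n < \<epsilon> / 2"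
    using \<epsilon> by (intro order_tendstoD) auto
  then show ?thesis
  proof eventually_elim
    case (elim n)
    have "real (card (hits \<eta> (A n) K)) \<le> ?d * measure \<theta>G (A n + C) * measure \<theta>H T" by (intro C compact_A)
    also have "\<dots> \<le> ?d * (measure \<theta>G (A n) + measure \<theta>G (van_Hove_boundary C (A n))) * measure \<theta>H T"
      using dens_pos by (intro mult_right_mono mult_left_mono haar_measure_plus_le haar_G compact_A C) auto
    finally have "freq n K \<eta> \<le> ?d * (measure \<theta>G (A n) + measure \<theta>G (van_Hove_boundary C (A n))) * measure \<theta>H T / measure \<theta>G (A n)"
      unfolding freq_def using measure_A_pos[of n] by (intro divide_right_mono) auto
    also have "\<dots> = ?d * measure \<theta>H T + ?d * measure \<theta>H T * ?r n"
      using measure_A_pos[of n] by (simp add: field_simps)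
    finally show ?case using elim dT by linarith
  qed
qed

lemma freq_translate:
  assumes P: "compact P"
  shows "\<exists>r. r \<longlonglongrightarrow> 0 \<and> (\<forall>n. freq n P (\<eta> + (s, 0)) \<le> freq n P \<eta> + r n)"
proof -
  obtain K c where K: "compact K" "\<And>R. compact R \<Longrightarrow>
      real (card (hits (\<eta> + (s, 0)) R P)) \<le> real (card (hits \<eta> R P)) + c * measure \<theta>G (van_Hove_boundary K R)"
    using card_hits_translate_le[OF P] by blast
  let ?r = "\<lambda>n. c * (measure \<theta>G (van_Hove_boundary K (A n)) / measure \<theta>G (A n))"
  have "?r \<longlonglongrightarrow> c * 0" by (intro tendsto_intros measure_boundary_tendsto_0 K)
  moreover have "freq n P (\<eta> + (s, 0)) \<le> freq n P \<eta> + ?r n" for n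
    using divide_right_mono[OF K(2)[OF compact_A, of n], of "measure \<theta>G (A n)"]
    by (simp add: freq_def add_divide_distrib)
  ultimately show ?thesis by (intro exI[of _ ?r]) auto
qed

text \<open>The parameter \<open>(0, snd e + snd \<eta>)\<close> arises from \<open>\<eta>\<close>
  by adding the lattice vector \<open>e\<close>, which leaves the count unchanged, and translating
  in \<open>G\<close>, which costs a null sequence. So no reference parameter has asymptotically
  more than the frequency at \<open>\<eta>\<close>.\<close>

lemma freq_lattice_translate:
  assumes P: "compact P" and e: "e \<in> \<L>"
  shows "\<exists>r. r \<longlonglongrightarrow> 0 \<and> (\<forall>n. freq n P (0, snd e + snd \<eta>) \<le> freq n P \<eta> + r n)"
proof -
  have "freq n P (0, snd e + snd \<eta>) = freq n P (\<eta> + (- fst e - fst \<eta>, 0))" for n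
  proof -
    have "(0, snd e + snd \<eta>) = (\<eta> + (- fst e - fst \<eta>, 0)) + e" by (simp add: prod_eq_iff add.commute)
    then show ?thesis unfolding freq_def using card_hits_lattice_translate[OF e] by metis
  qed
  then show ?thesis using freq_translate[OF P, of \<eta> "- fst e - fst \<eta>"] by simp
qed

text \<open>Each of the \<open>card E\<close> reference parameters contributes a power of 2 whose
  exponent is at most the measure of \<open>A n\<close> times the frequencies at
  \<open>\<eta>\<close> plus a null sequence. After taking logarithms the factor
  \<open>card E\<close> vanishes because that measure tends to infinity. The free \<open>m\<close>
  covers both kinds of pattern numbers.\<close>

lemma window_patterns_ln_bound:
  assumes W: "compact (closure W)" "compact (closure W')" and B: "B \<subseteq> B'" "compact B'"
    and U: "compact U" "0 \<in> interior U"
  shows "\<exists>a. a \<longlonglongrightarrow> 0 \<and> (\<forall>n m. m \<le> card (window_patterns (A n) W W' B) \<longrightarrow>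
      ln (real m) / measure \<theta>G (A n)
        \<le> a n + (freq n (van_Hove_boundary U W) \<eta> + freq n (van_Hove_boundary U W') \<eta>) * ln 2)"
proof -
  obtain E where E: "finite E" "E \<subseteq> \<L>"
    "\<forall>R. compact R \<longrightarrow> finite (window_patterns R W W' B) \<and> card (window_patterns R W W' B) \<le>
      (\<Sum>e\<in>E. 2 ^ (card (hits (0, snd e + snd \<eta>) R (van_Hove_boundary U W))
                 + card (hits (0, snd e + snd \<eta>) R (van_Hove_boundary U W'))))"
    using window_patterns_bound[OF W B U, of "snd \<eta>"] by (elim exE conjE)
  have bW: "compact (van_Hove_boundary U W)" "compact (van_Hove_boundary U W')"
    using U(1) W by (intro compact_van_Hove_boundary; simp)+
  have "\<forall>e\<in>E. \<exists>r. r \<longlonglongrightarrow> 0 \<and>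
      (\<forall>n. freq n (van_Hove_boundary U W) (0, snd e + snd \<eta>) \<le> freq n (van_Hove_boundary U W) \<eta> + r n)"
    using freq_lattice_translate[OF bW(1)] E(2) by blast
  then obtain r where r: "\<And>e. e \<in> E \<Longrightarrow> r e \<longlonglongrightarrow> 0"
      "\<And>e n. e \<in> E \<Longrightarrow> freq n (van_Hove_boundary U W) (0, snd e + snd \<eta>) \<le> freq n (van_Hove_boundary U W) \<eta> + r e n"
    unfolding bchoice_iff by blast
  have "\<forall>e\<in>E. \<exists>r. r \<longlonglongrightarrow> 0 \<and>
      (\<forall>n. freq n (van_Hove_boundary U W') (0, snd e + snd \<eta>) \<le> freq n (van_Hove_boundary U W') \<eta> + r n)"
    using freq_lattice_translate[OF bW(2)] E(2) by blast
  then obtain r' where r': "\<And>e. e \<in> E \<Longrightarrow> r' e \<longlonglongrightarrow> 0"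
      "\<And>e n. e \<in> E \<Longrightarrow> freq n (van_Hove_boundary U W') (0, snd e + snd \<eta>) \<le> freq n (van_Hove_boundary U W') \<eta> + r' e n"
    unfolding bchoice_iff by blast
  \<comment> \<open>One null sequence dominating all errors; absolute values let the finite sum
    bound each of its terms.\<close>
  define s where "s n = (\<Sum>e\<in>E. \<bar>r e n\<bar> + \<bar>r' e n\<bar>)" for n
  have s: "s \<longlonglongrightarrow> (\<Sum>e\<in>E. \<bar>0\<bar> + \<bar>0\<bar>)"
    unfolding s_def[abs_def] by (intro tendsto_intros r r')
  have s_ge: "r e n + r' e n \<le> s n" if "e \<in> E" for e n
  proof -
    have "r e n + r' e n \<le> \<bar>r e n\<bar> + \<bar>r' e n\<bar>" by linarith
    also have "\<dots> \<le> s n" unfolding s_def using E(1) that by (intro member_le_sum) auto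
    finally show ?thesis .
  qed
  \<comment> \<open>The extra 1 ensures \<open>k \<ge> 1\<close>, hence \<open>ln k \<ge> 0\<close>,
    even for empty \<open>E\<close>.\<close>
  define k where "k = real (card E) + 1"
  define a where "a n = ln k / measure \<theta>G (A n) + s n * ln 2" for n
  have "a \<longlonglongrightarrow> 0 + (\<Sum>e\<in>E. \<bar>0\<bar> + \<bar>0\<bar>) * ln 2"
    unfolding a_def[abs_def]
    by (intro tendsto_intros s real_tendsto_divide_at_top[OF tendsto_const] van_Hove_measure_at_top[OF haar_G van_Hove noncompact])
  then have a: "a \<longlonglongrightarrow> 0" by simp
  show ?thesis
  proof (intro exI[of _ a] conjI a allI impI)
    fix n m assume m: "m \<le> card (window_patterns (A n) W W' B)"
    let ?f = "freq n (van_Hove_boundary U W) \<eta> + freq n (van_Hove_boundary U W') \<eta>"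
    let ?t = "measure \<theta>G (A n)"
    have t: "?t > 0" by (rule measure_A_pos)
    have f0: "?f \<ge> 0" by (simp add: freq_def)
    have s0: "s n \<ge> 0" by (simp add: s_def sum_nonneg)
    have k1: "k \<ge> 1" by (simp add: k_def)
    have "real m \<le> (\<Sum>e\<in>E. 2 ^ (card (hits (0, snd e + snd \<eta>) (A n) (van_Hove_boundary U W))
                 + card (hits (0, snd e + snd \<eta>) (A n) (van_Hove_boundary U W'))))"
      using order_trans[OF m conjunct2[OF E(3)[rule_format, OF compact_A]]] by (simp flip: of_nat_le_iff[where 'a = real])
    also have "\<dots> \<le> (\<Sum>e\<in>E. 2 powr (?t * (?f + s n)))"
    proof (rule sum_mono)
      fix e assume e: "e \<in> E"
      let ?c = "card (hits (0, snd e + snd \<eta>) (A n) (van_Hove_boundary U W))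
                 + card (hits (0, snd e + snd \<eta>) (A n) (van_Hove_boundary U W'))"
      have "real ?c = ?t * (freq n (van_Hove_boundary U W) (0, snd e + snd \<eta>)
            + freq n (van_Hove_boundary U W') (0, snd e + snd \<eta>))"
        by (simp add: card_hits_eq_freq distrib_left)
      also have "\<dots> \<le> ?t * (?f + s n)"
        using r(2)[OF e, of n] r'(2)[OF e, of n] s_ge[OF e, of n] t by (intro mult_left_mono) linarith+
      finally have "2 powr real ?c \<le> (2::real) powr (?t * (?f + s n))" by (intro powr_mono) auto
      then show "(2::real) ^ ?c \<le> 2 powr (?t * (?f + s n))"
        using powr_realpow[of "2::real" ?c] by (simp only: zero_less_numeral simp_thms)
    qed
    also have "\<dots> \<le> k * 2 powr (?t * (?f + s n))"
      by (simp add: k_def)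
    finally have m_le: "real m \<le> k * 2 powr (?t * (?f + s n))" .
    have "ln (real m) \<le> ln k + ?t * (?f + s n) * ln 2"
    \<comment> \<open>For \<open>m = 0\<close> the left-hand side is \<open>ln 0 = 0\<close> and the
      right-hand side is nonnegative.\<close>
    proof (cases "m = 0")
      case True
      then show ?thesis using k1 t f0 s0 by simp
    next
      case False
      then have "ln (real m) \<le> ln (k * 2 powr (?t * (?f + s n)))" using m_le k1 by (intro ln_mono) auto
      also have "\<dots> = ln k + ?t * (?f + s n) * ln 2" using k1 by (simp add: ln_mult ln_powr)
      finally show ?thesis .
    qed
    then have "ln (real m) / ?t \<le> (ln k + ?t * (?f + s n) * ln 2) / ?t"
      using t by (intro divide_right_mono) auto
    also have "\<dots> = a n + ?f * ln 2" using t by (simp add: a_def field_simps)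
    finally show "ln (real m) / ?t \<le> a n + ?f * ln 2" .
  qed
qed

text \<open>The null sequence drops out of the limsup, and the empty second window has frequency
  0.\<close>

lemma limsup_window_patterns_le_freq:
  assumes W: "compact (closure W)" and B: "B \<subseteq> B'" "compact B'"
    and U: "compact U" "0 \<in> interior U"
    and m: "\<And>n. m n \<le> card (window_patterns (A n) W {} B)"
  shows "limsup (\<lambda>n. ereal (ln (real (m n)) / measure \<theta>G (A n)))
    \<le> limsup (\<lambda>n. ereal (freq n (van_Hove_boundary U W) \<eta>)) * ereal (ln 2)"
proof -
  obtain a where a: "a \<longlonglongrightarrow> 0" "\<And>n. ln (real (m n)) / measure \<theta>G (A n)
        \<le> a n + freq n (van_Hove_boundary U W) \<eta> * ln 2"
    using window_patterns_ln_bound[OF W _ B U, of "{}" \<eta>] m by auto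
  have "limsup (\<lambda>n. ereal (ln (real (m n)) / measure \<theta>G (A n)))
      \<le> limsup (\<lambda>n. ereal (a n) + ereal (freq n (van_Hove_boundary U W) \<eta>) * ereal (ln 2))"
    using a(2) by (intro Limsup_mono always_eventually allI) simp
  also have "\<dots> = 0 + limsup (\<lambda>n. ereal (freq n (van_Hove_boundary U W) \<eta>) * ereal (ln 2))"
    using a(1) by (intro ereal_limsup_lim_add) (auto simp: zero_ereal_def)
  also have "\<dots> = limsup (\<lambda>n. ereal (freq n (van_Hove_boundary U W) \<eta>)) * ereal (ln 2)"
    unfolding add_0_left by (intro Limsup_ereal_mult_right) auto
  finally show ?thesis .
qed

lemma limsup_freq_le:
  assumes "compact K"
  shows "limsup (\<lambda>n. ereal (freq n K \<eta>)) \<le> ereal (dens \<theta>G \<theta>H \<L> * measure \<theta>H K)"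
proof (rule ereal_le_epsilon2)
  fix \<epsilon> :: real assume "0 < \<epsilon>"
  from freq_eventually_le[OF assms this]
  show "limsup (\<lambda>n. ereal (freq n K \<eta>)) \<le> ereal (dens \<theta>G \<theta>H \<L> * measure \<theta>H K) + ereal \<epsilon>"
    by (intro Limsup_bounded) simp
qed

text \<open>For each \<open>\<epsilon>\<close> a single \<open>U\<close> is fixed, so small that
  both van Hove boundaries lie in open sets barely larger than the frontiers; no limit in
  \<open>U\<close> is interchanged with the limsup.\<close>

lemma limsup_window_patterns_le_frontier:
  assumes W: "compact (closure W)" "compact (closure W')" and B: "B \<subseteq> B'" "compact B'"
    and m: "\<And>n. m n \<le> card (window_patterns (A n) W W' B)"
  shows "limsup (\<lambda>n. ereal (ln (real (m n)) / measure \<theta>G (A n)))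
    \<le> ereal (dens \<theta>G \<theta>H \<L> * (measure \<theta>H (frontier W) + measure \<theta>H (frontier W')) * ln 2)"
proof (rule ereal_le_epsilon2)
  let ?d = "dens \<theta>G \<theta>H \<L>"
  fix \<epsilon> :: real assume \<epsilon>: "0 < \<epsilon>"
  have ln2: "ln 2 > (0::real)" "ln 2 \<le> (1::real)" using ln_2_less_1 by auto
  \<comment> \<open>Five shares of \<open>\<epsilon>\<close>: outer regularity and frequency for
    each of the two windows, and the null sequence. The factor \<open>ln 2 \<le> 1\<close> does not
    enlarge them.\<close>
  define \<delta> where "\<delta> = \<epsilon> / 5 / ?d"
  have \<delta>: "\<delta> > 0" "?d * \<delta> = \<epsilon> / 5" using \<epsilon> dens_pos by (auto simp: \<delta>_def)
  have cf: "compact (frontier X)" if "compact (closure X)" for X :: "'h set"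
    using compact_diff[OF that open_interior] by (simp add: frontier_def)
  obtain T where T: "open T" "frontier W \<subseteq> T" "T \<in> fmeasurable \<theta>H" "measure \<theta>H T < measure \<theta>H (frontier W) + \<delta>"
    by (rule haar_measure_outer_regular_compact[OF haar_H cf[OF W(1)] \<delta>(1)])
  obtain T' where T': "open T'" "frontier W' \<subseteq> T'" "T' \<in> fmeasurable \<theta>H" "measure \<theta>H T' < measure \<theta>H (frontier W') + \<delta>"
    by (rule haar_measure_outer_regular_compact[OF haar_H cf[OF W(2)] \<delta>(1)])
  obtain V where V: "open V" "0 \<in> V" "\<And>U. U \<subseteq> V \<Longrightarrow> van_Hove_boundary U W \<subseteq> T"
    using van_Hove_boundary_shrink[OF sigma_compact_H W(1) T(1,2)] by blast
  obtain V' where V': "open V'" "0 \<in> V'" "\<And>U. U \<subseteq> V' \<Longrightarrow> van_Hove_boundary U W' \<subseteq> T'"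
    using van_Hove_boundary_shrink[OF sigma_compact_H W(2) T'(1,2)] by blast
  obtain U where U: "compact U" "0 \<in> interior U" "U \<subseteq> V \<inter> V'"
    using compact_neighbourhood_zero[OF sigma_compact_H, of "V \<inter> V'"] V(1,2) V'(1,2) by auto
  have bW: "compact (van_Hove_boundary U W)" "compact (van_Hove_boundary U W')"
    using U(1) W by (intro compact_van_Hove_boundary; simp)+
  have "measure \<theta>H (van_Hove_boundary U W) \<le> measure \<theta>H T"
    using V(3)[of U] U(3) T bW(1) haar_measure_compact_fmeasurable[OF haar_H bW(1)]
    by (intro measure_mono_fmeasurable) (auto intro: fmeasurableD)
  then have 1: "?d * measure \<theta>H (van_Hove_boundary U W) \<le> ?d * measure \<theta>H (frontier W) + \<epsilon> / 5"
    using T(4) dens_pos \<delta>(2)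
    by (metis distrib_left less_imp_le mult_left_mono order_trans)
  have "measure \<theta>H (van_Hove_boundary U W') \<le> measure \<theta>H T'"
    using V'(3)[of U] U(3) T' bW(2) haar_measure_compact_fmeasurable[OF haar_H bW(2)]
    by (intro measure_mono_fmeasurable) (auto intro: fmeasurableD)
  then have 2: "?d * measure \<theta>H (van_Hove_boundary U W') \<le> ?d * measure \<theta>H (frontier W') + \<epsilon> / 5"
    using T'(4) dens_pos \<delta>(2)
    by (metis distrib_left less_imp_le mult_left_mono order_trans)
  obtain a where a: "a \<longlonglongrightarrow> 0" "\<And>n. ln (real (m n)) / measure \<theta>G (A n)
        \<le> a n + (freq n (van_Hove_boundary U W) 0 + freq n (van_Hove_boundary U W') 0) * ln 2"
    using window_patterns_ln_bound[OF W B U(1,2), of 0] m by blast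
  have \<epsilon>5: "\<epsilon> / 5 > 0" using \<epsilon> by simp
  have "\<forall>\<^sub>F n in sequentially. a n < \<epsilon> / 5" using a(1) \<epsilon>5 by (rule order_tendstoD)
  then have "\<forall>\<^sub>F n in sequentially. ln (real (m n)) / measure \<theta>G (A n)
      \<le> ?d * (measure \<theta>H (frontier W) + measure \<theta>H (frontier W')) * ln 2 + \<epsilon>"
    using freq_eventually_le[OF bW(1) \<epsilon>5, of 0] freq_eventually_le[OF bW(2) \<epsilon>5, of 0]
  proof eventually_elim
    case (elim n)
    let ?s = "?d * (measure \<theta>H (frontier W) + measure \<theta>H (frontier W'))"
    have "freq n (van_Hove_boundary U W) 0 + freq n (van_Hove_boundary U W') 0 \<le> ?s + 4 * \<epsilon> / 5"
      using elim(2,3) 1 2 by (simp add: distrib_left)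
    then have "(freq n (van_Hove_boundary U W) 0 + freq n (van_Hove_boundary U W') 0) * ln 2 \<le> (?s + 4 * \<epsilon> / 5) * ln 2"
      using ln2 by (intro mult_right_mono) auto
    also have "\<dots> \<le> ?s * ln 2 + 4 * \<epsilon> / 5"
      using ln2 \<epsilon> mult_left_mono[OF ln2(2), of "4 * \<epsilon> / 5"] by (simp add: distrib_right)
    finally show ?case using a(2)[of n] elim(1) by linarith
  qed
  then show "limsup (\<lambda>n. ereal (ln (real (m n)) / measure \<theta>G (A n)))
    \<le> ereal (?d * (measure \<theta>H (frontier W) + measure \<theta>H (frontier W')) * ln 2) + ereal \<epsilon>"
    by (intro Limsup_bounded) simp
qed

end

section \<open>The three entropy bounds\<close>

theorem theorem4p5:
  fixes \<L> :: "('g::{topological_ab_group_add, t2_space} \<times> 'h::{topological_ab_group_add, t2_space}) set"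
    and \<theta>G :: "'g measure" and \<theta>H :: "'h measure"
    and W :: "'h set" and A :: "nat \<Rightarrow> 'g set"
  assumes "cut_and_project_scheme \<L>"
    and "haar_measure \<theta>G" and "haar_measure \<theta>H"
    and "\<not> compact (UNIV :: 'g set)"
    and "relatively_compact W"
    and "van_Hove_sequence \<theta>G A"
  shows
    "(\<forall>\<xi> :: 'g \<times> 'h. \<forall>U :: 'h set. compact U \<and> 0 \<in> interior U \<longrightarrow>
        pattern_entropy \<theta>G A (model_set \<L> W)
          \<le> limsup (\<lambda>n. ereal (relative_frequency \<theta>G \<L> A n (van_Hove_boundary U W) \<xi>)) * ereal (ln 2) \<and>
        limsup (\<lambda>n. ereal (relative_frequency \<theta>G \<L> A n (van_Hove_boundary U W) \<xi>)) * ereal (ln 2)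
          \<le> ereal (dens \<theta>G \<theta>H \<L> * measure \<theta>H (van_Hove_boundary U W) * ln 2)) \<and>
     pattern_entropy \<theta>G A (model_set \<L> W)
       \<le> ereal (dens \<theta>G \<theta>H \<L> * measure \<theta>H (frontier W) * ln 2) \<and>
     (\<forall>W\<^sub>0 :: 'h set. relatively_compact W\<^sub>0 \<and> measure \<theta>H (frontier W\<^sub>0) = 0 \<and> W \<subseteq> W\<^sub>0 \<longrightarrow>
        coloured_pattern_entropy \<theta>G A (model_set \<L> W) (model_set \<L> W\<^sub>0)
          \<le> ereal (dens \<theta>G \<theta>H \<L> * measure \<theta>H (frontier W) * ln 2))"
proof -
  interpret cut_and_project_van_Hove \<L> \<theta>G \<theta>H A
    using assms by unfold_locales
  have W: "compact (closure W)" using assms(5) by (simp add: relatively_compact_def)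
  have freq: "relative_frequency \<theta>G \<L> A n P \<xi> = freq n P (fst \<xi>, - snd \<xi>)" for n P \<xi>
    by (simp add: relative_frequency_eq freq_def)
  \<comment> \<open>Some compact unit neighbourhood, chosen to obtain finiteness of the sets of
    pairs.\<close>
  obtain U\<^sub>0 :: "'h set" where U\<^sub>0: "compact U\<^sub>0" "0 \<in> interior U\<^sub>0"
    using compact_neighbourhood_zero[OF sigma_compact_H, of UNIV] by auto
  have fin: "finite (window_patterns (A n) W X B)" if "compact (closure X)" "compact (closure B)" for n X B
    using window_patterns_bound[OF W that(1) closure_subset that(2) U\<^sub>0] compact_A by blast
  have N: "pattern_number (A n) (model_set \<L> W) \<le> card (window_patterns (A n) W {} W)" for n
    using W by (intro pattern_number_le_window_patterns fin) simp_all
  show ?thesis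
  proof (intro conjI allI impI; (elim conjE)?)
    fix \<xi> :: "'g \<times> 'h" and U :: "'h set" assume U: "compact U" "0 \<in> interior U"
    show "pattern_entropy \<theta>G A (model_set \<L> W)
          \<le> limsup (\<lambda>n. ereal (relative_frequency \<theta>G \<L> A n (van_Hove_boundary U W) \<xi>)) * ereal (ln 2)"
      unfolding pattern_entropy_def freq
      by (rule limsup_window_patterns_le_freq[OF W closure_subset W U N])
    have "limsup (\<lambda>n. ereal (freq n (van_Hove_boundary U W) (fst \<xi>, - snd \<xi>))) * ereal (ln 2)
        \<le> ereal (dens \<theta>G \<theta>H \<L> * measure \<theta>H (van_Hove_boundary U W)) * ereal (ln 2)"
      by (intro ereal_mult_right_mono limsup_freq_le compact_van_Hove_boundary U W) simp
    then show "limsup (\<lambda>n. ereal (relative_frequency \<theta>G \<L> A n (van_Hove_boundary U W) \<xi>)) * ereal (ln 2)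
          \<le> ereal (dens \<theta>G \<theta>H \<L> * measure \<theta>H (van_Hove_boundary U W) * ln 2)"
      unfolding freq by simp
  next
    \<comment> \<open>The second window is empty, and so is its frontier.\<close>
    show "pattern_entropy \<theta>G A (model_set \<L> W)
       \<le> ereal (dens \<theta>G \<theta>H \<L> * measure \<theta>H (frontier W) * ln 2)"
      using limsup_window_patterns_le_frontier[OF W _ closure_subset W N] by (simp add: pattern_entropy_def)
  next
    fix W\<^sub>0 :: "'h set" assume W\<^sub>0: "relatively_compact W\<^sub>0" "measure \<theta>H (frontier W\<^sub>0) = 0"
    have cW\<^sub>0: "compact (closure W\<^sub>0)" using W\<^sub>0(1) by (simp add: relatively_compact_def)
    have "coloured_pattern_number (A n) (model_set \<L> W) (model_set \<L> W\<^sub>0)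
        \<le> card (window_patterns (A n) W W\<^sub>0 W\<^sub>0)" for n
      by (intro coloured_pattern_number_le_window_patterns fin cW\<^sub>0)
    \<comment> \<open>Pairs are indexed by \<open>b\<close> in \<open>W\<^sub>0\<close>; the
      frontier of \<open>W\<^sub>0\<close> is null, so only that of \<open>W\<close>
      contributes.\<close>
    from limsup_window_patterns_le_frontier[OF W cW\<^sub>0 closure_subset cW\<^sub>0 this] W\<^sub>0(2)
    show "coloured_pattern_entropy \<theta>G A (model_set \<L> W) (model_set \<L> W\<^sub>0)
          \<le> ereal (dens \<theta>G \<theta>H \<L> * measure \<theta>H (frontier W) * ln 2)"
      by (simp add: coloured_pattern_entropy_def)
  qed
qed

end
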